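(* Let $X$ be a second countable compact Hausdorff space, let $T:X\to X$ be a surjective local homeomorphism and let $g\in C(X,\mathbf{R}_+^* )$. Assume that: (i) the equivalence relation $R(X,T)=\{(x,y)\in X\times X:\exists n\in\mathbf{N},\ T^nx=T^ny\}$ is minimal; (ii) there exist an integer $L\ge 1$ and a $T^L$-cover $(\mathcal V,\mathcal U)$ which is a generator for the stationary sequence defined by $T^L$; (iii) there exists an integer $M\ge 1$ such that $g_M=\prod_{j=0}^{M-1}g\circ T^j$ satisfies Walters' condition with respect to $T^M$. Then the stationary cocycle $D$ defined by $g$ on $R(X,T)$ is uniquely ergodic, i.e. there is exactly one probability measure on $X$ which is quasi-invariant under $R(X,T)$ with Radon-Nikodym derivative $D$.
   Context: $\mathbf{R}_+^*=(0,\infty)$, $\mathbf N=\{0,1,2,\dots\}$. Topology and cocycle. $R_n=\{(x,y):T^nx=T^ny\}\subset X\times X$ has the relative product topology and $R=R(X,T)=\bigcup_nR_n$ the inductive limit topology ($W$ open iff $W\cap R_n$ open in $R_n$ for all $n$). $R$ is minimal if every equivalence class is dense in $X$. The stationary cocycle defined by $g$ is the continuous function $D:R\to\mathbf{R}_+^*$, $D(x,y)=\prod_{j=0}^{n-1}g(T^jx)/\prod_{j=0}^{n-1}g(T^jy)$ if $T^nx=T^ny$. A probability measure $\mu$ is quasi-invariant with Radon-Nikodym derivative $D$ iff $\int\sum_{y:(x,y)\in R}f(x,y)\,d\mu(x)=\int\sum_{x:(x,y)\in R} f(x,y)D(x,y)\,d\mu(y)$ for all $f\in C_c(R)$. Covers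 and generators. Let $S:X\to X$ be a surjective local homeomorphism (here $S=T^L$). An $S$-cover $(\mathcal V,\mathcal U)$ consists of a finite open cover $\mathcal V$ of $X$ and, for each $V\in\mathcal V$, a partition of $S^{-1}(V)$ into finitely many open sets $U$ each mapped homeomorphically onto $V$ by $S$; $\mathcal U$ is the open cover of $X$ consisting of all these sets $U$. To speak of a generator one requires $\mathcal U\prec\mathcal V$: for each $U\in\mathcal U$ there is $V\in\mathcal V$ with $\overline U\subset V$; fix such a $V=V(U)$ for each $U$. Let $\mathcal U_n$ be the family of sets $U_1\cap S^{-1}(U_2)\cap\dots\cap S^{-(n-1)}(U_n)$ with $U_1,\dots,U_n\in\mathcal U$ and $S(U_k)=V(U_{k+1})$ for $1\le k<n$, and let $\Delta_{\mathcal U_n}=\bigcup_{U\in\mathcal U_n}U\times U$. The $S$-cover $(\mathcal V,\mathcal U)$ is a generator if $\bigcap_n\Delta_{\mathcal U_n}$ is the diagonal of $X\times X$. Walters' condition. For $h\in C(X,\mathbf{R}_+^* )$ and $\Delta\subset X\times X$ let $var_*(h,\Delta)=\sup_{(x,x')\in\Delta}\left|\frac{h(x)}{h(x')}-1\right|$. For a continuous map $S:X\to X$, $h\in C(X,\mathbf{R}_+^* )$ satisfies Walters' condition with respect to $S$ if for every $\epsilon>0$ there is an entourage $\Delta$ of the uniform structure of $X$ such that the decreasing sequence $\Delta_n=\{(x,y)\in X\times X:(S^kx,S^ky)\in\Delta\ \text{for } k=0,1,\dots,n-1\}$ has intersection equal to the diagonal, and $var_*\big(\prod_{j=0}^{n-1}h\circ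 S^j,\Delta_n\big)\le\epsilon$ for all $n\ge1$. *)

theory Defs
  imports "HOL-Probability.Probability" "HOL-Library.Disjoint_Sets"
begin

definition local_homeomorphism :: "('a::topological_space \<Rightarrow> 'a) \<Rightarrow> bool" where
  "local_homeomorphism T \<longleftrightarrow>
     (\<forall>x. \<exists>U h. open U \<and> x \<in> U \<and> open (T ` U) \<and> homeomorphism U (T ` U) T h)"

definition tail_rel_level :: "('a \<Rightarrow> 'a) \<Rightarrow> nat \<Rightarrow> ('a \<times> 'a) set" where
  "tail_rel_level T n = {(x, y). (T ^^ n) x = (T ^^ n) y}"

definition tail_rel :: "('a \<Rightarrow> 'a) \<Rightarrow> ('a \<times> 'a) set" where
  "tail_rel T = (\<Union>n. tail_rel_level T n)"

definition minimal_rel :: "('a::topological_space \<times> 'a) set \<Rightarrow> bool" where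
  "minimal_rel R \<longleftrightarrow> (\<forall>x. closure {y. (x, y) \<in> R} = UNIV)"

text \<open>The inductive limit topology on \<^term>\<open>tail_rel T\<close>. It is in general finer than the
  topology induced by the product, so it is given as an abstract topology.\<close>

definition tail_topology :: "('a::topological_space \<Rightarrow> 'a) \<Rightarrow> ('a \<times> 'a) topology" where
  "tail_topology T = topology (\<lambda>W. W \<subseteq> tail_rel T \<and>
     (\<forall>n. openin (top_of_set (tail_rel_level T n)) (W \<inter> tail_rel_level T n)))"

lemma openin_tail_topology:
  "openin (tail_topology T) W \<longleftrightarrow> W \<subseteq> tail_rel T \<and>
     (\<forall>n. openin (top_of_set (tail_rel_level T n)) (W \<inter> tail_rel_level T n))"
proof -
  let ?P = "\<lambda>W. W \<subseteq> tail_rel T \<and>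
     (\<forall>n. openin (top_of_set (tail_rel_level T n)) (W \<inter> tail_rel_level T n))"
  have "istopology ?P"
    unfolding istopology_def
  proof (intro conjI allI impI)
    fix A B n assume A: "?P A" and B: "?P B"
    show "A \<inter> B \<subseteq> tail_rel T" using A by blast
    have "A \<inter> B \<inter> tail_rel_level T n = (A \<inter> tail_rel_level T n) \<inter> (B \<inter> tail_rel_level T n)"
      by blast
    then show "openin (top_of_set (tail_rel_level T n)) (A \<inter> B \<inter> tail_rel_level T n)"
      using A B openin_Int by metis
  next
    fix \<K> n assume K: "\<forall>W\<in>\<K>. ?P W"
    show "\<Union>\<K> \<subseteq> tail_rel T" using K by blast
    have "\<Union>\<K> \<inter> tail_rel_level T n = (\<Union>W\<in>\<K>. W \<inter> tail_rel_level T n)" by blast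
    then show "openin (top_of_set (tail_rel_level T n)) (\<Union>\<K> \<inter> tail_rel_level T n)"
      by (simp only:) (rule openin_Union, use K in blast)
  qed
  then show ?thesis
    by (simp add: tail_topology_def topology_inverse')
qed

lemma topspace_tail_topology: "topspace (tail_topology T) = tail_rel T"
proof -
  have "openin (tail_topology T) (tail_rel T)"
  proof -
    have "tail_rel T \<inter> tail_rel_level T n = tail_rel_level T n" for n
      by (auto simp: tail_rel_def)
    then show ?thesis by (simp add: openin_tail_topology)
  qed
  then show ?thesis
    using openin_subset[of "tail_topology T" "tail_rel T"]
      openin_topspace[of "tail_topology T"] openin_tail_topology[of T "topspace (tail_topology T)"]
    by (intro subset_antisym) simp_all
qed

text \<open>\<open>C\<^sub>c(R)\<close>: complex-valued, as usual for groupoids. Only the values on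
  \<^term>\<open>tail_rel T\<close> matter.\<close>

definition Cc_tail :: "('a::topological_space \<Rightarrow> 'a) \<Rightarrow> ('a \<times> 'a \<Rightarrow> complex) set" where
  "Cc_tail T = {f. continuous_map (tail_topology T) euclidean f \<and>
     compactin (tail_topology T)
       (tail_topology T closure_of {p \<in> tail_rel T. f p \<noteq> 0})}"

definition orbit_prod :: "('a \<Rightarrow> real) \<Rightarrow> ('a \<Rightarrow> 'a) \<Rightarrow> nat \<Rightarrow> 'a \<Rightarrow> real" where
  "orbit_prod h S n x = (\<Prod>j<n. h ((S ^^ j) x))"

text \<open>The quotient does not depend on the choice of \<open>n\<close> with \<open>T\<^sup>n x = T\<^sup>n y\<close> (see
  \<open>stationary_cocycle_eq\<close>); the least one is used. Outside \<^term>\<open>tail_rel T\<close> the value is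
  irrelevant.\<close>

definition stationary_cocycle :: "('a \<Rightarrow> real) \<Rightarrow> ('a \<Rightarrow> 'a) \<Rightarrow> 'a \<times> 'a \<Rightarrow> real" where
  "stationary_cocycle g T = (\<lambda>(x, y).
     let n = (LEAST n. (T ^^ n) x = (T ^^ n) y)
     in orbit_prod g T n x / orbit_prod g T n y)"

lemma stationary_cocycle_eq:
  assumes pos: "\<And>x. g x > 0" and eq: "(T ^^ n) x = (T ^^ n) y"
  shows "stationary_cocycle g T (x, y) = orbit_prod g T n x / orbit_prod g T n y"
proof -
  define m where "m = (LEAST n. (T ^^ n) x = (T ^^ n) y)"
  have m: "(T ^^ m) x = (T ^^ m) y" and le: "m \<le> n"
    unfolding m_def using eq by (rule LeastI, rule Least_le)
  have split: "orbit_prod g T n z = orbit_prod g T m z * (\<Prod>j\<in>{m..<n}. g ((T ^^ j) z))" for z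
    unfolding orbit_prod_def lessThan_atLeast0 using le
    by (simp add: prod.atLeastLessThan_concat)
  have "(T ^^ j) x = (T ^^ j) y" if "m \<le> j" for j
    using m funpow_add[of "j - m" m T] that by simp
  then have "(\<Prod>j\<in>{m..<n}. g ((T ^^ j) x)) = (\<Prod>j\<in>{m..<n}. g ((T ^^ j) y))"
    by (intro prod.cong) auto
  moreover have "(\<Prod>j\<in>{m..<n}. g ((T ^^ j) y)) > 0"
    using pos by (intro prod_pos) auto
  ultimately show ?thesis
    unfolding stationary_cocycle_def Let_def prod.case m_def[symmetric] split
    by (metis less_irrefl mult_divide_mult_cancel_right)
qed

text \<open>The sums are written as unordered sums; for \<^term>\<open>f \<in> Cc_tail T\<close> they have only
  finitely many nonzero terms when \<open>X\<close> is compact Hausdorff and \<open>T\<close> is a local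
  homeomorphism.\<close>

definition quasi_invariant_RN ::
    "('a::topological_space \<Rightarrow> 'a) \<Rightarrow> ('a \<times> 'a \<Rightarrow> real) \<Rightarrow> 'a measure \<Rightarrow> bool" where
  "quasi_invariant_RN T D \<mu> \<longleftrightarrow> (\<forall>f \<in> Cc_tail T.
     (\<integral>x. (\<Sum>\<^sub>\<infinity>y\<in>{y. (x, y) \<in> tail_rel T}. f (x, y)) \<partial>\<mu>) =
     (\<integral>y. (\<Sum>\<^sub>\<infinity>x\<in>{x. (x, y) \<in> tail_rel T}. f (x, y) * complex_of_real (D (x, y))) \<partial>\<mu>))"

definition uniquely_ergodic ::
    "('a::topological_space \<Rightarrow> 'a) \<Rightarrow> ('a \<times> 'a \<Rightarrow> real) \<Rightarrow> bool" where
  "uniquely_ergodic T D \<longleftrightarrow>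
     (\<exists>!\<mu>. sets \<mu> = sets borel \<and> prob_space \<mu> \<and> quasi_invariant_RN T D \<mu>)"

definition S_cover ::
    "('a::topological_space \<Rightarrow> 'a) \<Rightarrow> 'a set set \<Rightarrow> 'a set set \<Rightarrow> bool" where
  "S_cover S \<V> \<U> \<longleftrightarrow>
     finite \<V> \<and> (\<forall>V\<in>\<V>. open V) \<and> \<Union>\<V> = UNIV \<and>
     (\<exists>P. (\<forall>V\<in>\<V>. finite (P V) \<and> partition_on (S -` V) (P V) \<and>
                 (\<forall>U\<in>P V. open U \<and> (\<exists>h. homeomorphism U V S h))) \<and>
          \<U> = (\<Union>V\<in>\<V>. P V))"

text \<open>A choice \<^term>\<open>v\<close> of \<open>V(U)\<close> for every \<open>U\<close>; its existence is the condition
  \<open>\<U> \<prec> \<V>\<close>.\<close>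

definition refining_choice ::
    "'a::topological_space set set \<Rightarrow> 'a set set \<Rightarrow> ('a set \<Rightarrow> 'a set) \<Rightarrow> bool" where
  "refining_choice \<V> \<U> v \<longleftrightarrow> (\<forall>U\<in>\<U>. v U \<in> \<V> \<and> closure U \<subseteq> v U)"

text \<open>\<^term>\<open>u k\<close> plays the role of \<open>U\<^sub>k\<^sub>+\<^sub>1\<close>.\<close>

definition cover_level ::
    "('a \<Rightarrow> 'a) \<Rightarrow> 'a set set \<Rightarrow> ('a set \<Rightarrow> 'a set) \<Rightarrow> nat \<Rightarrow> 'a set set" where
  "cover_level S \<U> v n = {\<Inter>k<n. (S ^^ k) -` u k | u.
     (\<forall>k<n. u k \<in> \<U>) \<and> (\<forall>k. Suc k < n \<longrightarrow> S ` u k = v (u (Suc k)))}"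

definition generator ::
    "('a::topological_space \<Rightarrow> 'a) \<Rightarrow> 'a set set \<Rightarrow> 'a set set \<Rightarrow> bool" where
  "generator S \<V> \<U> \<longleftrightarrow> S_cover S \<V> \<U> \<and>
     (\<exists>v. refining_choice \<V> \<U> v \<and>
       (\<Inter>n\<in>{1..}. \<Union>U\<in>cover_level S \<U> v n. U \<times> U) = Id)"

text \<open>The entourages of the unique uniformity of a compact Hausdorff space are the
  neighbourhoods of the diagonal; \<open>entourage_iff_uniformity\<close> checks this against the library
  class of uniform spaces.\<close>

definition entourage :: "('a::topological_space \<times> 'a) set \<Rightarrow> bool" where
  "entourage \<Delta> \<longleftrightarrow> Id \<subseteq> interior \<Delta>"

lemma entourage_iff_uniformity:
  fixes \<Delta> :: "('a::uniform_space \<times> 'a) set"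
  assumes "compact (UNIV :: 'a set)"
  shows "entourage \<Delta> \<longleftrightarrow> eventually (\<lambda>p. p \<in> \<Delta>) uniformity"
proof
  assume ev: "eventually (\<lambda>p. p \<in> \<Delta>) uniformity"
  have "(x, x) \<in> interior \<Delta>" for x
  proof -
    obtain D where D: "eventually D uniformity"
      and DD: "\<And>x y z. D (x, y) \<Longrightarrow> D (y, z) \<Longrightarrow> (x, z) \<in> \<Delta>"
      using uniformity_transE[OF ev] by blast
    define E where "E p \<longleftrightarrow> D p \<and> (case p of (a, b) \<Rightarrow> D (b, a))" for p
    have E: "eventually E uniformity"
      unfolding E_def using D uniformity_sym[OF D] by (rule eventually_conj)
    have "eventually (\<lambda>y. E (x, y)) (nhds x)"
      unfolding eventually_nhds_uniformity using E by (rule eventually_mono) auto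
    then obtain W where W: "open W" "x \<in> W" "\<And>y. y \<in> W \<Longrightarrow> E (x, y)"
      unfolding eventually_nhds by blast
    have "W \<times> W \<subseteq> \<Delta>"
      using W(3) DD unfolding E_def by fastforce
    then show ?thesis
      using W(2) interior_maximal[OF _ open_Times[OF W(1) W(1)]] by blast
  qed
  then show "entourage \<Delta>" by (auto simp: entourage_def)
next
  assume ent: "entourage \<Delta>"
  have "\<exists>W D. open W \<and> x \<in> W \<and> eventually D uniformity \<and>
          (\<forall>y z. y \<in> W \<longrightarrow> D (y, z) \<longrightarrow> (y, z) \<in> \<Delta>)" for x
  proof -
    have "(x, x) \<in> interior \<Delta>" using ent by (auto simp: entourage_def)
    then obtain A B where AB: "open A" "open B" "x \<in> A" "x \<in> B" "A \<times> B \<subseteq> interior \<Delta>"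
      by (metis open_interior open_prod_elim mem_Sigma_iff)
    have ev: "eventually (\<lambda>(x', y). x' = x \<longrightarrow> y \<in> A \<inter> B) uniformity"
      unfolding eventually_nhds_uniformity[symmetric] eventually_nhds
      using AB by (intro exI[of _ "A \<inter> B"]) auto
    obtain D where D: "eventually D uniformity"
      and DD: "\<And>x' y z. D (x', y) \<Longrightarrow> D (y, z) \<Longrightarrow> (case (x', z) of (x', y) \<Rightarrow> x' = x \<longrightarrow> y \<in> A \<inter> B)"
      using uniformity_transE[OF ev] by blast
    have "eventually (\<lambda>y. D (x, y) \<and> y \<in> A) (nhds x)"
    proof (rule eventually_conj)
      show "eventually (\<lambda>y. D (x, y)) (nhds x)"
        unfolding eventually_nhds_uniformity using D by (rule eventually_mono) auto
      show "eventually (\<lambda>y. y \<in> A) (nhds x)"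
        using AB by (simp add: eventually_nhds_in_open)
    qed
    then obtain W where W: "open W" "x \<in> W" "\<And>y. y \<in> W \<Longrightarrow> D (x, y) \<and> y \<in> A"
      unfolding eventually_nhds by blast
    have "(y, z) \<in> \<Delta>" if "y \<in> W" "D (y, z)" for y z
    proof -
      have "z \<in> B" using DD[of x y z] W(3)[OF that(1)] that(2) by auto
      then show ?thesis using W(3)[OF that(1)] AB(5) interior_subset by blast
    qed
    then show ?thesis using W D by blast
  qed
  then obtain W D where WD: "\<And>x. open (W x)" "\<And>x. x \<in> W x" "\<And>x. eventually (D x) uniformity"
    "\<And>x y z. y \<in> W x \<Longrightarrow> D x (y, z) \<Longrightarrow> (y, z) \<in> \<Delta>"
    by metis
  obtain F where F: "finite F" "UNIV \<subseteq> (\<Union>x\<in>F. W x)"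
    using compactE_image[OF assms, of UNIV W] WD(1,2) by (metis UNIV_I UN_I subsetI)
  have "eventually (\<lambda>p. \<forall>x\<in>F. D x p) uniformity"
    using F(1) WD(3) by (simp add: eventually_ball_finite)
  then show "eventually (\<lambda>p. p \<in> \<Delta>) uniformity"
  proof (rule eventually_mono)
    fix p assume p: "\<forall>x\<in>F. D x p"
    obtain y z where yz: "p = (y, z)" by force
    obtain x where "x \<in> F" "y \<in> W x" using F(2) by blast
    then show "p \<in> \<Delta>" using p yz WD(4) by blast
  qed
qed

text \<open>A supremum of reals: it is only used for \<open>h\<close> continuous and positive on a compact space
  and \<open>\<Delta>\<close> nonempty, where the set of values is nonempty and bounded.\<close>

definition var_star :: "('a \<Rightarrow> real) \<Rightarrow> ('a \<times> 'a) set \<Rightarrow> real" where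
  "var_star h \<Delta> = (SUP (x, x')\<in>\<Delta>. \<bar>h x / h x' - 1\<bar>)"

definition entourage_level :: "('a \<Rightarrow> 'a) \<Rightarrow> ('a \<times> 'a) set \<Rightarrow> nat \<Rightarrow> ('a \<times> 'a) set" where
  "entourage_level S \<Delta> n = {(x, y). \<forall>k<n. ((S ^^ k) x, (S ^^ k) y) \<in> \<Delta>}"

definition walters_condition ::
    "('a::topological_space \<Rightarrow> 'a) \<Rightarrow> ('a \<Rightarrow> real) \<Rightarrow> bool" where
  "walters_condition S h \<longleftrightarrow> (\<forall>\<epsilon>>0. \<exists>\<Delta>. entourage \<Delta> \<and>
     (\<Inter>n\<in>{1..}. entourage_level S \<Delta> n) = Id \<and>
     (\<forall>n\<ge>1. var_star (orbit_prod h S n) (entourage_level S \<Delta> n) \<le> \<epsilon>))"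

end

theory Submission
  imports Defs
begin

text \<open>
  Let \<open>E\<^sub>n f (x)\<close> be the average of \<open>f\<close> over the finite set \<open>{z. T\<^sup>n z = T\<^sup>n x}\<close> with weights
  proportional to \<open>\<Prod>j<n. g (T\<^sup>j z)\<close>. Testing against functions supported on \<open>R\<^sub>n\<close> shows that a
  probability measure is quasi-invariant with Radon-Nikodym derivative \<open>D\<close> iff it is invariant under
  all the \<open>E\<^sub>n\<close>, and since \<open>E\<^sub>m E\<^sub>n = E\<^sub>m\<close> for \<open>n \<le> m\<close>, every weak limit point of the measures
  \<open>f \<mapsto> E\<^sub>n f (x)\<close> is one.

  For uniqueness, points in a common set of a fine cover given by the generator have preimages under
  \<open>T\<^sup>n\<close> that can be paired along shadowing orbits, and Walters' condition bounds the ratio of their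
  weights by \<open>2\<close> for all \<open>n\<close> in an arithmetic progression. Minimality makes some power of \<open>T\<close> map
  every set of the cover onto \<open>X\<close>, which turns this local comparison into a Harnack inequality
  \<open>E\<^sub>n f (x) \<le> C E\<^sub>n f (y)\<close> for continuous \<open>f > 0\<close>, with \<open>C\<close> independent of \<open>f\<close> and arbitrarily large
  \<open>n\<close>. Applied to \<open>E\<^sub>k f - min (E\<^sub>k f) + \<eta>\<close>, it contracts oscillations by a fixed factor, so
  some \<open>E\<^sub>n f\<close> is uniformly as close as desired to a constant, and all invariant measures agree on \<open>f\<close>.
\<close>

section \<open>Probability measures on compact second countable Hausdorff spaces\<close>

definition cantor_real :: "(nat \<Rightarrow> bool) \<Rightarrow> real" where
  "cantor_real s = (\<Sum>n. of_bool (s n) * 2 / 3 ^ Suc n)"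

lemma cantor_real_summable: "summable (\<lambda>n. of_bool (s n) * 2 / 3 ^ Suc n :: real)"
proof (rule summable_comparison_test')
  show "summable (\<lambda>n. 2 / 3 * (1 / 3) ^ n :: real)"
    by (intro summable_mult summable_geometric) simp
  show "norm (of_bool (s n) * 2 / 3 ^ Suc n :: real) \<le> 2 / 3 * (1 / 3) ^ n" if "n \<ge> 0" for n
    by (simp add: power_divide)
qed

lemma cantor_real_bounds: "0 \<le> cantor_real s" "cantor_real s \<le> 1"
proof -
  show "0 \<le> cantor_real s"
    unfolding cantor_real_def by (intro suminf_nonneg cantor_real_summable) simp
  have "(\<lambda>n. 2 / 3 * (1 / 3) ^ n :: real) sums (2 / 3 * (1 / (1 - 1 / 3)))"
    by (intro sums_mult geometric_sums) simp
  then have sums: "(\<lambda>n. 2 / 3 * (1 / 3) ^ n :: real) sums 1"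
    by simp
  have "cantor_real s \<le> (\<Sum>n. 2 / 3 * (1 / 3) ^ n)"
    unfolding cantor_real_def
    by (intro suminf_le cantor_real_summable sums_summable[OF sums]) (simp add: power_divide)
  then show "cantor_real s \<le> 1"
    using sums_unique[OF sums] by simp
qed

lemma cantor_real_shift: "cantor_real s = (2 * of_bool (s 0) + cantor_real (\<lambda>n. s (Suc n))) / 3"
proof -
  have "cantor_real s = (\<Sum>n. of_bool (s (Suc n)) * 2 / 3 ^ Suc n / 3) + 2 * of_bool (s 0) / 3"
    unfolding cantor_real_def using suminf_split_head[OF cantor_real_summable[of s]]
    by (simp add: field_simps)
  also have "(\<Sum>n. of_bool (s (Suc n)) * 2 / 3 ^ Suc n / 3) = cantor_real (\<lambda>n. s (Suc n)) / 3"
    unfolding cantor_real_def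
    using suminf_divide[OF cantor_real_summable[of "\<lambda>n. s (Suc n)"], of 3] by simp
  finally show ?thesis by (simp add: field_simps)
qed

text \<open>The base 3 digits are 0 and 2. By \<open>cantor_real_shift\<close> a leading
  \<open>False\<close> puts the value into [0, 1/3] and a leading \<open>True\<close> into [2/3, 1],
  so the first digit can be read off; shifting recovers the others one by one.\<close>

lemma inj_cantor_real: "inj cantor_real"
proof (rule injI, rule ext)
  fix s t n assume "cantor_real s = cantor_real t"
  then show "s n = t n"
  proof (induction n arbitrary: s t)
    case 0
    then show ?case
      using cantor_real_shift[of s] cantor_real_shift[of t]
        cantor_real_bounds[of "\<lambda>n. s (Suc n)"] cantor_real_bounds[of "\<lambda>n. t (Suc n)"]
      by (auto simp: of_bool_def split: if_splits)
  next
    case (Suc n)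
    have "s 0 = t 0"
      using Suc.prems cantor_real_shift[of s] cantor_real_shift[of t]
        cantor_real_bounds[of "\<lambda>n. s (Suc n)"] cantor_real_bounds[of "\<lambda>n. t (Suc n)"]
      by (auto simp: of_bool_def split: if_splits)
    then have "cantor_real (\<lambda>n. s (Suc n)) = cantor_real (\<lambda>n. t (Suc n))"
      using Suc.prems cantor_real_shift[of s] cantor_real_shift[of t] by simp
    from Suc.IH[OF this] show ?case .
  qed
qed

lemma continuous_on_cantor_real: "continuous_on A cantor_real"
proof -
  have "uniform_limit A (\<lambda>n s. \<Sum>i<n. of_bool (s i) * 2 / 3 ^ Suc i :: real)
      (\<lambda>s. \<Sum>i. of_bool (s i) * 2 / 3 ^ Suc i) sequentially"
  proof (rule Weierstrass_m_test)
    show "summable (\<lambda>n. 2 / 3 * (1 / 3) ^ n :: real)"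
      by (intro summable_mult summable_geometric) simp
    show "norm (of_bool (s n) * 2 / 3 ^ Suc n :: real) \<le> 2 / 3 * (1 / 3) ^ n" for s :: "nat \<Rightarrow> bool" and n
      by (simp add: power_divide)
  qed
  moreover have "continuous_on A (\<lambda>s. \<Sum>i<n. of_bool (s i) * 2 / 3 ^ Suc i :: real)" for n
  proof (intro continuous_intros)
    fix i
    have "continuous_on UNIV (of_bool :: bool \<Rightarrow> real)"
      by (simp add: continuous_on_open_vimage discrete_topology_class.open_discrete)
    then show "continuous_on A (\<lambda>s. of_bool (s i) :: real)"
      by (rule continuous_on_compose2) (auto intro: continuous_on_product_coordinates continuous_on_subset)
  qed auto
  ultimately show ?thesis
    unfolding cantor_real_def[abs_def]
    by (intro uniform_limit_theorem[OF always_eventually]) auto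
qed

section \<open>Compact second countable Hausdorff spaces as continuous images of compact sets of
  reals\<close>

lemma compact_UNIV_fun_bool: "compact (UNIV :: (nat \<Rightarrow> bool) set)"
proof -
  have "compact_space (product_topology (\<lambda>i::nat. euclidean :: bool topology) UNIV)"
    unfolding compact_space_product_topology
    by (simp add: compact_space_def finite_imp_compact)
  then show ?thesis
    by (metis compact_space_def compactin_euclidean_iff euclidean_product_topology topspace_euclidean)
qed

lemma open_fun_bool_agree: "open {t :: nat \<Rightarrow> bool. \<forall>n<N. t n = s n}"
proof -
  have "open {t :: nat \<Rightarrow> bool. t n = s n}" for n
    using open_vimage[OF discrete_topology_class.open_discrete[of "{s n}"] continuous_on_product_coordinates[of n]]
    by (simp add: vimage_def)
  then have "open (\<Inter>n\<in>{..<N}. {t :: nat \<Rightarrow> bool. t n = s n})"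
    by (intro open_INT) auto
  moreover have "(\<Inter>n\<in>{..<N}. {t. t n = s n}) = {t. \<forall>n<N. t n = s n}" by auto
  ultimately show ?thesis by simp
qed

text \<open>Compactness in finite-stage form. It serves with \<open>V\<close> empty to show that a
  set of codes is closed, with \<open>V\<close> a neighbourhood of a point for continuity of the
  decoding map, and later with \<open>V\<close> a neighbourhood of the diagonal for
  generators.\<close>

lemma compact_INT_closed_subset_open:
  fixes K :: "nat \<Rightarrow> 'a::topological_space set"
  assumes "compact (UNIV :: 'a set)" "\<And>n. closed (K n)" "open V" "(\<Inter>n. K n) \<subseteq> V"
  shows "\<exists>N. (\<Inter>n<N. K n) \<subseteq> V"
proof -
  have "UNIV \<subseteq> V \<union> (\<Union>n. - K n)" using assms(4) by auto
  then have "- V \<subseteq> (\<Union>n\<in>UNIV. - K n)" by auto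
  moreover have "compact (- V)"
    using assms(1,3) compact_Int_closed[of UNIV "- V"] by auto
  ultimately obtain F where F: "finite F" "- V \<subseteq> (\<Union>n\<in>F. - K n)"
    using compactE_image[of "- V" UNIV "\<lambda>n. - K n"] assms(2) by (metis open_Compl subset_UNIV)
  obtain N where "\<forall>n\<in>F. n < N" using F(1) finite_nat_set_iff_bounded by blast
  then have "(\<Inter>n<N. K n) \<subseteq> V" using F(2) by fastforce
  then show ?thesis ..
qed

text \<open>A point is coded by a choice, for every \<open>n\<close>, of a member of the \<open>n\<close>-th pair containing it;
  together with \<open>cantor_real\<close> this exhibits the space as a continuous image of a compact set of
  reals, on which Helly's selection theorem is available.\<close>

lemma closed_cover_address_space:
  fixes B :: "nat \<Rightarrow> bool \<Rightarrow> 'a::topological_space set"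
  assumes comp: "compact (UNIV :: 'a set)"
    and closed: "\<And>n b. closed (B n b)"
    and cover: "\<And>n. B n True \<union> B n False = UNIV"
    and sep: "\<And>x y. x \<noteq> y \<Longrightarrow> \<exists>n. \<forall>b. \<not> (x \<in> B n b \<and> y \<in> B n b)"
  shows "\<exists>K p. compact K \<and> continuous_on K (p :: (nat \<Rightarrow> bool) \<Rightarrow> 'a) \<and> p ` K = UNIV"
proof -
  define K where "K = {s. (\<Inter>n. B n (s n)) \<noteq> {}}"
  define p where "p s = (SOME x. x \<in> (\<Inter>n. B n (s n)))" for s
  have p: "p s \<in> B n (s n)" if "s \<in> K" for s n
  proof -
    have "\<exists>x. x \<in> (\<Inter>n. B n (s n))" using that unfolding K_def by blast
    from someI_ex[OF this] show ?thesis unfolding p_def by (rule INT_D) simp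
  qed
  have p_unique: "x = p s" if "s \<in> K" "\<And>n. x \<in> B n (s n)" for x s
  proof (rule ccontr)
    assume "x \<noteq> p s"
    then obtain n where "\<not> (x \<in> B n (s n) \<and> p s \<in> B n (s n))" using sep by blast
    then show False using that p by simp
  qed
  \<comment> \<open>If \<open>s\<close> codes no point, then finitely many of its closed sets
    already have empty intersection, and any sequence that agrees with \<open>s\<close> there codes
    no point either.\<close>
  have "open (- K)"
  proof (rule topological_space_class.openI)
    fix s assume "s \<in> - K"
    then have "(\<Inter>n. B n (s n)) \<subseteq> {}" by (simp add: K_def)
    then obtain N where N: "(\<Inter>n<N. B n (s n)) \<subseteq> {}"
      using compact_INT_closed_subset_open[OF comp, of "\<lambda>n. B n (s n)" "{}"] closed by blast
    show "\<exists>U. open U \<and> s \<in> U \<and> U \<subseteq> - K"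
    proof (intro exI conjI)
      show "open {t. \<forall>n<N. t n = s n}" by (rule open_fun_bool_agree)
      show "{t. \<forall>n<N. t n = s n} \<subseteq> - K"
      proof (intro subsetI ComplI)
        fix t assume t: "t \<in> {t. \<forall>n<N. t n = s n}" and "t \<in> K"
        then obtain x where x: "x \<in> B n (t n)" for n unfolding K_def by blast
        have "x \<in> B n (s n)" if "n < N" for n using x[of n] t that by simp
        then have "x \<in> (\<Inter>n<N. B n (s n))" by simp
        then show False using N by blast
      qed
    qed simp
  qed
  then have "compact K"
    using compact_UNIV_fun_bool compact_Int_closed[of UNIV K] by (simp add: closed_def)
  moreover have "continuous_on K p"
    unfolding continuous_on_topological
  proof (intro ballI allI impI)
    fix s V assume s: "s \<in> K" and V: "open V" "p s \<in> V"
    \<comment> \<open>By \<open>sep\<close> the sets selected by \<open>s\<close> meet in the single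
      point \<open>p s\<close>, so finitely many coordinates of \<open>s\<close> confine the decoded
      point to \<open>V\<close>.\<close>
    have "(\<Inter>n. B n (s n)) \<subseteq> V"
    proof
      fix x assume "x \<in> (\<Inter>n. B n (s n))"
      then have "x = p s" by (intro p_unique[OF s]) simp
      then show "x \<in> V" using V by simp
    qed
    then have "\<exists>N. (\<Inter>n<N. B n (s n)) \<subseteq> V"
      by (intro compact_INT_closed_subset_open[of "\<lambda>n. B n (s n)"] comp closed V(1))
    then obtain N where N: "(\<Inter>n<N. B n (s n)) \<subseteq> V" ..
    show "\<exists>A. open A \<and> s \<in> A \<and> (\<forall>t\<in>K. t \<in> A \<longrightarrow> p t \<in> V)"
    proof (intro exI conjI ballI impI)
      show "open {t. \<forall>n<N. t n = s n}" by (rule open_fun_bool_agree)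
      fix t assume "t \<in> K" "t \<in> {t. \<forall>n<N. t n = s n}"
      then have "p t \<in> B n (s n)" if "n < N" for n using p[of t n] that by simp
      then have "p t \<in> (\<Inter>n<N. B n (s n))" by simp
      then show "p t \<in> V" using N by blast
    qed simp
  qed
  moreover have "p ` K = UNIV"
  proof (intro equalityI subsetI)
    fix x :: 'a
    define s where "s n = (x \<in> B n True)" for n
    have x: "x \<in> B n (s n)" for n using cover[of n] by (cases "x \<in> B n True") (auto simp: s_def)
    then have "s \<in> K" unfolding K_def by blast
    then show "x \<in> p ` K" using p_unique[of s x] x by blast
  qed simp
  ultimately show ?thesis by blast
qed

lemma normal_space_euclidean_compact_t2:
  assumes "compact (UNIV :: 'a::t2_space set)"
  shows "normal_space (euclidean :: 'a topology)"
proof -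
  have "Hausdorff_space (euclidean :: 'a topology)"
    unfolding Hausdorff_space_def by (simp add: disjnt_def) (metis hausdorff)
  moreover have "compact_space (euclidean :: 'a topology)"
    using assms by (simp add: compact_space_def)
  ultimately show ?thesis
    using compact_Hausdorff_or_regular_imp_normal_space by blast
qed

lemma compact_t2_shrink:
  fixes x :: "'a::t2_space"
  assumes "compact (UNIV :: 'a set)" "open V" "x \<in> V"
  obtains W where "open W" "x \<in> W" "closure W \<subseteq> V"
proof -
  have "closedin (euclidean :: 'a topology) {x}" "closedin euclidean (- V)" "disjnt {x} (- V)"
    using assms by auto
  then obtain U W where "open U" "open W" "{x} \<subseteq> U" "- V \<subseteq> W" "disjnt U W"
    using normal_space_euclidean_compact_t2[OF assms(1)] unfolding normal_space_def
    by (metis open_openin)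
  moreover from this have "closure U \<subseteq> - W"
    by (intro closure_minimal) (auto simp: disjnt_def)
  ultimately show ?thesis using that[of U] by blast
qed

text \<open>Each basic set contributes the pair formed by its closure and its complement. Both are
  closed; they may overlap on the boundary, so a point can have several codes. For
  \<open>x \<noteq> y\<close> regularity gives a basic set that contains \<open>x\<close> and whose
  closure misses \<open>y\<close>, and no member of that pair contains both points.\<close>

lemma compact_t2_second_countable_image_compact_real:
  assumes comp: "compact (UNIV :: 'a::{t2_space, second_countable_topology} set)"
  shows "\<exists>K (p :: real \<Rightarrow> 'a). compact K \<and> K \<subseteq> {0..1} \<and> continuous_on K p \<and> p ` K = UNIV"
proof -
  obtain \<B> :: "'a set set" where \<B>: "countable \<B>" "topological_basis \<B>"
    using ex_countable_basis by blast
  have "\<B> \<noteq> {}"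
    using \<B>(2) topological_basisE[OF \<B>(2) open_UNIV UNIV_I] by (metis empty_iff)
  then have b: "range (from_nat_into \<B>) = \<B>" using \<B>(1) by (rule range_from_nat_into)
  define B where "B n b = (if b then closure (from_nat_into \<B> n) else - from_nat_into \<B> n)" for n b
  have bopen: "open (from_nat_into \<B> n)" for n
    using b \<B>(2) topological_basis_open by blast
  have "\<exists>K p. compact K \<and> continuous_on K (p :: (nat \<Rightarrow> bool) \<Rightarrow> 'a) \<and> p ` K = UNIV"
  proof (rule closed_cover_address_space[OF comp])
    show "closed (B n b)" for n b using bopen by (simp add: B_def closed_Compl)
    show "B n True \<union> B n False = UNIV" for n
      using closure_subset[of "from_nat_into \<B> n"] by (auto simp: B_def)
    fix x y :: 'a assume "x \<noteq> y"
    then have "x \<in> - {y}" by simp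
    then obtain W where W: "open W" "x \<in> W" "closure W \<subseteq> - {y}"
      by (rule compact_t2_shrink[OF comp open_Compl[OF closed_singleton]])
    obtain B' where "B' \<in> \<B>" "x \<in> B'" "B' \<subseteq> W"
      using topological_basisE[OF \<B>(2) W(1,2)] by blast
    obtain n where n: "from_nat_into \<B> n = B'"
      using from_nat_into_surj[OF \<B>(1) \<open>B' \<in> \<B>\<close>] ..
    have "y \<notin> closure B'" using W(3) closure_mono[OF \<open>B' \<subseteq> W\<close>] by blast
    then show "\<exists>n. \<forall>b. \<not> (x \<in> B n b \<and> y \<in> B n b)"
      using n \<open>x \<in> B'\<close> by (intro exI[of _ n]) (auto simp: B_def)
  qed
  then obtain K and p :: "(nat \<Rightarrow> bool) \<Rightarrow> 'a"
    where K: "compact K" "continuous_on K p" "p ` K = UNIV" by blast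
  \<comment> \<open>A continuous injection of a compact set into the reals is a homeomorphism onto
    its image, so decoding can start from the real number.\<close>
  obtain c where c: "homeomorphism K (cantor_real ` K) cantor_real c"
    using homeomorphism_compact[OF K(1) continuous_on_cantor_real refl] inj_cantor_real
    by (meson inj_on_subset subset_UNIV)
  show ?thesis
  proof (intro exI conjI)
    show "compact (cantor_real ` K)"
      by (intro compact_continuous_image continuous_on_cantor_real K)
    show "cantor_real ` K \<subseteq> {0..1}" using cantor_real_bounds by auto
    show "continuous_on (cantor_real ` K) (p \<circ> c)"
      using c K(2) by (intro continuous_on_compose) (auto simp: homeomorphism_def)
    show "(p \<circ> c) ` cantor_real ` K = UNIV"
      using c K(3) unfolding homeomorphism_def image_comp[symmetric] by simp
  qed
qed

text \<open>Sequential weak compactness by transport to the line: the measures are pushed to the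
  compact set \<open>K\<close> of reals by a section of \<open>p\<close>, a subsequence converges
  there, Skorohod's theorem turns weak convergence into pointwise convergence of random variables,
  and \<open>p\<close> carries these back to the space, where dominated convergence applies.\<close>

lemma pmf_sequence_weak_limit:
  fixes P :: "nat \<Rightarrow> 'a::{t2_space, second_countable_topology} pmf"
  assumes comp: "compact (UNIV :: 'a set)"
  obtains r \<mu> where "strict_mono (r :: nat \<Rightarrow> nat)" "sets \<mu> = sets borel" "prob_space \<mu>"
    "\<And>f :: 'a \<Rightarrow> real. continuous_on UNIV f \<Longrightarrow>
       (\<lambda>k. measure_pmf.expectation (P (r k)) f) \<longlonglongrightarrow> integral\<^sup>L \<mu> f"
proof -
  obtain K and p :: "real \<Rightarrow> 'a"
    where K: "compact K" "K \<subseteq> {0..1}" "continuous_on K p" "p ` K = UNIV"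
    using compact_t2_second_countable_image_compact_real[OF comp] by blast
  have Kb: "K \<in> sets borel" and Kc: "closed K" using K(1) by (auto simp: compact_imp_closed borel_compact)
  \<comment> \<open>An arbitrary section of \<open>p\<close>, which may fail to be Borel. For a
    \<open>pmf\<close> every function is measurable, which is why the measures are given in this
    form.\<close>
  define q where "q x = (SOME t. t \<in> K \<and> p t = x)" for x
  have q: "q x \<in> K" "p (q x) = x" for x
  proof -
    have "\<exists>t. t \<in> K \<and> p t = x" using K(4) by (metis UNIV_I imageE)
    from someI_ex[OF this] show "q x \<in> K" "p (q x) = x" by (simp_all add: q_def)
  qed
  define M where "M n = distr (measure_pmf (P n)) borel q" for n
  have Mp: "prob_space (M n)" for n
    unfolding M_def by (intro measure_pmf.prob_space_distr) simp
  have Mr: "real_distribution (M n)" for n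
    unfolding real_distribution_def real_distribution_axioms_def using Mp by (simp add: M_def)
  have "tight M"
    unfolding tight_def
  proof (intro conjI allI impI)
    fix \<epsilon> :: real assume "\<epsilon> > 0"
    \<comment> \<open>The half-open interval excludes its left end, hence -1 rather than 0.\<close>
    have "q x \<in> {-1<..1}" for x using subsetD[OF K(2) q(1), of x] by simp
    then have "q -` {-1<..1} = UNIV" by blast
    then have "measure (M n) {-1<..1} = 1" for n
      by (simp add: M_def measure_distr)
    then show "\<exists>a b. a < b \<and> (\<forall>n. 1 - \<epsilon> < measure (M n) {a<..b})"
      using \<open>\<epsilon> > 0\<close> by (intro exI[of _ "-1"] exI[of _ 1]) auto
  qed (rule Mr)
  then obtain r M0 where r: "strict_mono (r :: nat \<Rightarrow> nat)" "real_distribution M0"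
      "weak_conv_m (M \<circ> id \<circ> r) M0"
    using tight_imp_convergent_subsubsequence[of M id] by (auto simp: strict_mono_def)
  have "real_distribution ((M \<circ> id \<circ> r) n)" for n using Mr by simp
  from Skorohod[OF this r(2,3)] obtain \<Omega> :: "real measure" and Ys Y where sk: "prob_space \<Omega>"
    "\<forall>n. Ys n \<in> measurable \<Omega> borel" "\<forall>n. distr \<Omega> borel (Ys n) = (M \<circ> id \<circ> r) n"
    "Y \<in> measurable \<Omega> lborel" "\<forall>x\<in>space \<Omega>. (\<lambda>n. Ys n x) \<longlonglongrightarrow> Y x"
    by blast
  have \<Omega>: "prob_space \<Omega>" "\<And>n. Ys n \<in> measurable \<Omega> borel"
    "\<And>n. distr \<Omega> borel (Ys n) = M (r n)" "Y \<in> measurable \<Omega> lborel"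
    "\<And>x. x \<in> space \<Omega> \<Longrightarrow> (\<lambda>n. Ys n x) \<longlonglongrightarrow> Y x"
    using sk by simp_all
  interpret \<Omega>: prob_space \<Omega> by fact
  have Y: "Y \<in> measurable \<Omega> borel" using \<Omega>(4) by simp
  \<comment> \<open>The representing variables stay in \<open>K\<close> almost surely, and so does
    their limit because \<open>K\<close> is closed; continuity of \<open>p\<close> is known on
    \<open>K\<close> only.\<close>
  have "AE \<omega> in \<Omega>. Ys n \<omega> \<in> K" for n
  proof -
    have "AE t in M (r n). t \<in> K"
      unfolding M_def using q Kb by (subst AE_distr_iff) auto
    then show ?thesis
      unfolding \<Omega>(3)[symmetric] using \<Omega>(2) Kb by (subst (asm) AE_distr_iff) auto
  qed
  then have YsK: "AE \<omega> in \<Omega>. \<forall>n. Ys n \<omega> \<in> K" by (simp add: AE_all_countable)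
  have YK: "Y \<omega> \<in> K" if "\<omega> \<in> space \<Omega>" "\<forall>n. Ys n \<omega> \<in> K" for \<omega>
    using closed_sequentially[OF Kc, of "\<lambda>n. Ys n \<omega>"] \<Omega>(5) that by blast
  \<comment> \<open>A constant value outside \<open>K\<close> makes the map Borel on the whole line;
    \<open>p 0\<close> is an arbitrary default.\<close>
  define p' where "p' t = (if t \<in> K then p t else p 0)" for t
  have p'[measurable]: "p' \<in> borel_measurable borel"
    unfolding p'_def using K(3) Kb by (intro borel_measurable_continuous_on_if) auto
  define \<mu> where "\<mu> = distr \<Omega> borel (\<lambda>\<omega>. p' (Y \<omega>))"
  have mY: "(\<lambda>\<omega>. p' (Y \<omega>)) \<in> measurable \<Omega> borel"
    using measurable_compose[OF Y p'] .
  show ?thesis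
  proof (rule that[OF r(1)])
    show "sets \<mu> = sets borel" by (simp add: \<mu>_def)
    show "prob_space \<mu>" unfolding \<mu>_def by (intro \<Omega>.prob_space_distr mY)
    fix f :: "'a \<Rightarrow> real" assume f: "continuous_on UNIV f"
    have fm[measurable]: "f \<in> borel_measurable borel"
      using f by (rule borel_measurable_continuous_onI)
    have "bounded (range f)" using compact_continuous_image[OF f comp] by (rule compact_imp_bounded)
    then obtain B where B: "norm (f x) \<le> B" for x
      unfolding bounded_iff by auto
    have fp'[measurable]: "(\<lambda>t. f (p' t)) \<in> borel_measurable borel"
      using measurable_compose[OF p' fm] .
    have "(\<lambda>k. \<integral>\<omega>. f (p' (Ys k \<omega>)) \<partial>\<Omega>) \<longlonglongrightarrow> (\<integral>\<omega>. f (p' (Y \<omega>)) \<partial>\<Omega>)"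
    proof (rule integral_dominated_convergence[where w = "\<lambda>_. B"])
      show "(\<lambda>\<omega>. f (p' (Y \<omega>))) \<in> borel_measurable \<Omega>"
        using measurable_compose[OF Y fp'] .
      show "(\<lambda>\<omega>. f (p' (Ys k \<omega>))) \<in> borel_measurable \<Omega>" for k
        using measurable_compose[OF \<Omega>(2) fp'] .
      show "AE \<omega> in \<Omega>. (\<lambda>k. f (p' (Ys k \<omega>))) \<longlonglongrightarrow> f (p' (Y \<omega>))"
        using YsK AE_space
      proof eventually_elim
        case (elim \<omega>)
        have "(\<lambda>k. f (p (Ys k \<omega>))) \<longlonglongrightarrow> f (p (Y \<omega>))"
        proof (rule continuous_on_tendsto_compose[of K "\<lambda>t. f (p t)"])
          show "continuous_on K (\<lambda>t. f (p t))"
            using continuous_on_compose2[OF f K(3)] by simp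
        qed (use elim \<Omega>(5) YK in auto)
        then show ?case using elim YK by (simp add: p'_def)
      qed
    qed (use B in auto)
    moreover have "(\<integral>\<omega>. f (p' (Ys k \<omega>)) \<partial>\<Omega>) = measure_pmf.expectation (P (r k)) f" for k
    proof -
      have "(\<integral>\<omega>. f (p' (Ys k \<omega>)) \<partial>\<Omega>) = (\<integral>t. f (p' t) \<partial>distr \<Omega> borel (Ys k))"
        using \<Omega>(2) by (simp add: integral_distr)
      also have "\<dots> = measure_pmf.expectation (P (r k)) (\<lambda>x. f (p' (q x)))"
        unfolding \<Omega>(3) M_def by (simp add: integral_distr)
      finally show ?thesis using q by (simp add: p'_def)
    qed
    moreover have "integral\<^sup>L \<mu> f = (\<integral>\<omega>. f (p' (Y \<omega>)) \<partial>\<Omega>)"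
      unfolding \<mu>_def using mY by (simp add: integral_distr)
    ultimately show "(\<lambda>k. measure_pmf.expectation (P (r k)) f) \<longlonglongrightarrow> integral\<^sup>L \<mu> f"
      by simp
  qed
qed

section \<open>Continuous functions determine a Borel probability measure\<close>

lemma open_indicator_limit_continuous:
  fixes U :: "'a::{t2_space, second_countable_topology} set"
  assumes comp: "compact (UNIV :: 'a set)" and U: "open U"
  obtains f :: "nat \<Rightarrow> 'a \<Rightarrow> real" where "\<And>n. continuous_on UNIV (f n)"
    "\<And>n x. f n x \<in> {0..1}" "\<And>x. (\<lambda>n. f n x) \<longlonglongrightarrow> indicator U x"
proof -
  obtain \<B> :: "'a set set" where \<B>: "countable \<B>" "topological_basis \<B>"
    using ex_countable_basis by blast
  \<comment> \<open>By regularity \<open>U\<close> is the union of the basic sets whose closures lie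
    in \<open>U\<close>. The empty set is added so that the family can be enumerated even if
    \<open>U\<close> is empty.\<close>
  define \<C> where "\<C> = insert {} {B \<in> \<B>. closure B \<subseteq> U}"
  have \<C>: "countable \<C>" "\<C> \<noteq> {}" using \<B>(1) by (auto simp: \<C>_def)
  define c where "c = from_nat_into \<C>"
  have c: "closure (c n) \<subseteq> U" for n
    using from_nat_into[OF \<C>(2), of n] by (auto simp: c_def \<C>_def)
  \<comment> \<open>A Urysohn function that is 1 on \<open>C n\<close> and 0 off \<open>U\<close>
    takes the value 1 at any given point of \<open>U\<close> for all large \<open>n\<close>; this
    gives the pointwise limit.\<close>
  define C where "C n = (\<Union>k\<le>n. closure (c k))" for n
  have "\<exists>f :: 'a \<Rightarrow> real. continuous_on UNIV f \<and> (\<forall>x. f x \<in> {0..1}) \<and> (\<forall>x\<in>C n. f x = 1) \<and> (\<forall>x. x \<notin> U \<longrightarrow> f x = 0)" for n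
  proof -
    have "closedin (euclidean :: 'a topology) (- U)" "closedin (euclidean :: 'a topology) (C n)"
      "disjnt (- U) (C n)"
      using U c by (auto simp: C_def disjnt_def)
    then obtain f where "continuous_map euclidean (top_of_set {0..1::real}) f" "f ` (- U) \<subseteq> {0}" "f ` C n \<subseteq> {1}"
      using Urysohn_lemma[OF normal_space_euclidean_compact_t2[OF comp], of "- U" "C n" 0 1] by auto
    then show ?thesis
      by (intro exI[of _ f]) (auto simp: continuous_map_in_subtopology image_subset_iff)
  qed
  then obtain f :: "nat \<Rightarrow> 'a \<Rightarrow> real" where f: "\<And>n. continuous_on UNIV (f n)" "\<And>n x. f n x \<in> {0..1}"
    "\<And>n x. x \<in> C n \<Longrightarrow> f n x = 1" "\<And>n x. x \<notin> U \<Longrightarrow> f n x = 0"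
    by metis
  show ?thesis
  proof (rule that[of f])
    fix x
    show "(\<lambda>n. f n x) \<longlonglongrightarrow> indicator U x"
    proof (cases "x \<in> U")
      case True
      then obtain W where W: "open W" "x \<in> W" "closure W \<subseteq> U"
        by (rule compact_t2_shrink[OF comp U])
      obtain B where B: "B \<in> \<B>" "x \<in> B" "B \<subseteq> W"
        using topological_basisE[OF \<B>(2) W(1,2)] by blast
      then have "B \<in> \<C>" using W closure_mono[OF B(3)] by (auto simp: \<C>_def)
      then obtain k where k: "c k = B" using from_nat_into_surj[OF \<C>(1)] by (auto simp: c_def)
      have "x \<in> C n" if "n \<ge> k" for n
        using k B(2) closure_subset[of B] that by (auto simp: C_def)
      then have "eventually (\<lambda>n. f n x = indicator U x) sequentially"
        unfolding eventually_sequentially using f(3) True by (intro exI[of _ k]) auto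
      then show ?thesis by (rule tendsto_eventually)
    qed (simp add: f)
  qed (use f in auto)
qed

text \<open>Open sets generate the Borel sets and are stable under intersection, and their measures
  are limits of integrals of continuous functions by dominated convergence.\<close>

lemma prob_measure_eqI_continuous:
  fixes \<mu> \<nu> :: "'a::{t2_space, second_countable_topology} measure"
  assumes comp: "compact (UNIV :: 'a set)"
    and \<mu>: "sets \<mu> = sets borel" "prob_space \<mu>" and \<nu>: "sets \<nu> = sets borel" "prob_space \<nu>"
    and eq: "\<And>f :: 'a \<Rightarrow> real. continuous_on UNIV f \<Longrightarrow> integral\<^sup>L \<mu> f = integral\<^sup>L \<nu> f"
  shows "\<mu> = \<nu>"
proof -
  interpret \<mu>: prob_space \<mu> by fact
  interpret \<nu>: prob_space \<nu> by fact
  have *: "emeasure \<mu> U = emeasure \<nu> U" if U: "open U" for U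
  proof -
    obtain f :: "nat \<Rightarrow> 'a \<Rightarrow> real" where f: "\<And>n. continuous_on UNIV (f n)"
      "\<And>n x. f n x \<in> {0..1}" "\<And>x. (\<lambda>n. f n x) \<longlonglongrightarrow> indicator U x"
      using open_indicator_limit_continuous[OF comp U] by blast
    have lim: "(\<lambda>n. integral\<^sup>L \<kappa> (f n)) \<longlonglongrightarrow> measure \<kappa> U" if \<kappa>: "sets \<kappa> = sets borel" "prob_space \<kappa>" for \<kappa>
    proof -
      interpret \<kappa>: prob_space \<kappa> by fact
      have U: "U \<in> sets \<kappa>" using \<open>open U\<close> \<kappa> by simp
      have "(\<lambda>n. integral\<^sup>L \<kappa> (f n)) \<longlonglongrightarrow> (\<integral>x. indicator U x \<partial>\<kappa>)"
      proof (rule integral_dominated_convergence[where w = "\<lambda>_. 1"])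
        show "f n \<in> borel_measurable \<kappa>" for n
          using borel_measurable_continuous_onI[OF f(1)] measurable_cong_sets[OF \<kappa>(1) refl] by blast
        show "AE x in \<kappa>. norm (f n x) \<le> 1" for n using f(2) by auto
      qed (use U f(3) in auto)
      then show ?thesis using U sets.sets_into_space[OF U] by (simp add: Int_absorb2)
    qed
    have "measure \<mu> U = measure \<nu> U"
      using LIMSEQ_unique[OF lim[OF \<mu>]] lim[OF \<nu>] eq[OF f(1)] by simp
    then show ?thesis by (simp add: \<mu>.emeasure_eq_measure \<nu>.emeasure_eq_measure)
  qed
  show ?thesis
  proof (rule measure_eqI_generator_eq[where E = "{U. open U}" and \<Omega> = UNIV and A = "\<lambda>_. UNIV"])
    show "Int_stable {U :: 'a set. open U}" by (auto simp: Int_stable_def)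
    show "sets \<mu> = sigma_sets UNIV {U. open U}" "sets \<nu> = sigma_sets UNIV {U. open U}"
      using \<mu> \<nu> by (simp_all add: borel_def)
  qed (use * in auto)
qed

section \<open>Fibres of local homeomorphisms and transfer operators\<close>

text \<open>Continuous, open and locally injective: this form passes to iterates
  (\<open>funpow\<close>), so every fact below about \<open>T\<close> is available for each
  \<open>T ^^ n\<close> by interpretation.\<close>

locale compact_local_homeo =
  fixes T :: "'a::t2_space \<Rightarrow> 'a"
  assumes compact_UNIV: "compact (UNIV :: 'a set)"
    and continuous_T: "continuous_on UNIV T"
    and open_map_T: "open U \<Longrightarrow> open (T ` U)"
    and locally_inj_T: "\<exists>U. open U \<and> x \<in> U \<and> inj_on T U"
begin

lemma funpow: "compact_local_homeo (T ^^ n)"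
proof (induction n)
  case 0
  show ?case by unfold_locales (auto simp: compact_UNIV continuous_on_id intro: inj_on_id)
next
  case (Suc n)
  interpret Tn: compact_local_homeo "T ^^ n" by fact
  show ?case
  proof
    show "continuous_on UNIV (T ^^ Suc n)"
      using continuous_on_compose2[OF continuous_T Tn.continuous_T] by simp
    show "open ((T ^^ Suc n) ` U)" if "open U" for U
      using open_map_T[OF Tn.open_map_T[OF that]] by (simp add: image_comp)
    fix x
    obtain U where U: "open U" "x \<in> U" "inj_on (T ^^ n) U" using Tn.locally_inj_T by blast
    obtain V where V: "open V" "(T ^^ n) x \<in> V" "inj_on T V" using locally_inj_T by blast
    have "inj_on (T ^^ Suc n) (U \<inter> (T ^^ n) -` V)"
      using U(3) V(3) by (auto simp: inj_on_def)
    moreover have "open (U \<inter> (T ^^ n) -` V)"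
      using U V Tn.continuous_T by (intro open_Int open_vimage)
    ultimately show "\<exists>U. open U \<and> x \<in> U \<and> inj_on (T ^^ Suc n) U"
      using U(2) V(2) by blast
  qed (rule compact_UNIV)
qed

lemma closed_map_T: "closed K \<Longrightarrow> closed (T ` K)"
  using compact_UNIV compact_Int_closed[of UNIV K] continuous_T
  by (auto intro!: compact_imp_closed compact_continuous_image intro: continuous_on_subset)

lemma finite_fibre: "finite (T -` {u})"
proof -
  obtain O' where O': "\<And>x. open (O' x)" "\<And>x. x \<in> O' x" "\<And>x. inj_on T (O' x)"
    using locally_inj_T by metis
  obtain F where F: "finite F" "UNIV \<subseteq> (\<Union>x\<in>F. O' x)"
    using compactE_image[OF compact_UNIV, of UNIV O'] O' by (metis UNIV_I UN_I subsetI)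
  have "T -` {u} = (\<Union>x\<in>F. T -` {u} \<inter> O' x)" using F(2) by auto
  moreover have "finite (T -` {u} \<inter> O' x)" for x
    by (rule inj_on_finite[of T _ "{u}"]) (use O'(3) in \<open>auto intro: inj_on_subset\<close>)
  ultimately show ?thesis using F(1) by (metis finite_UN)
qed

text \<open>Near \<open>u0\<close> the fibre moves along local inverse branches \<open>s y\<close>,
  one through each point \<open>y\<close> of the finite fibre over \<open>u0\<close>. The Hausdorff
  property keeps different branches apart, and closedness of \<open>T\<close> excludes further
  preimages.\<close>

lemma fibre_sections:
  obtains s where "\<And>y. T y = u0 \<Longrightarrow> (s y \<longlongrightarrow> y) (nhds u0)"
    and "eventually (\<lambda>u. bij_betw (\<lambda>y. s y u) (T -` {u0}) (T -` {u})) (nhds u0)"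
proof -
  obtain O' where O': "\<And>x. open (O' x)" "\<And>x. x \<in> O' x" "\<And>x. inj_on T (O' x)"
    using locally_inj_T by metis
  define s where "s y u = inv_into (O' y) T u" for y u
  let ?F = "T -` {u0}"
  have near: "eventually (\<lambda>u. u \<in> T ` W) (nhds u0)" if "open W" "y \<in> W" "T y = u0" for W y
    using open_map_T[OF that(1)] that(2,3) by (auto intro!: eventually_nhds_in_open)
  have s_eq: "s y (T z) = z" if "z \<in> O' y" for y z
    unfolding s_def using O'(3) that by (simp add: inv_into_f_f)
  have lim: "(s y \<longlongrightarrow> y) (nhds u0)" if y: "T y = u0" for y
  proof (rule topological_tendstoI)
    fix W assume "open W" "y \<in> W"
    then have "eventually (\<lambda>u. u \<in> T ` (W \<inter> O' y)) (nhds u0)"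
      using O'(1,2) y by (intro near[of _ y]) auto
    then show "eventually (\<lambda>u. s y u \<in> W) (nhds u0)"
      by eventually_elim (auto simp: s_eq)
  qed
  have mem: "eventually (\<lambda>u. \<forall>y\<in>?F. s y u \<in> O' y \<and> T (s y u) = u) (nhds u0)"
  proof (rule eventually_ball_finite[OF finite_fibre], intro ballI)
    fix y assume "y \<in> ?F"
    then have "eventually (\<lambda>u. u \<in> T ` O' y) (nhds u0)" using O'(1,2) by (intro near[of _ y]) auto
    then show "eventually (\<lambda>u. s y u \<in> O' y \<and> T (s y u) = u) (nhds u0)"
      by eventually_elim (auto simp: s_eq)
  qed
  have distinct: "eventually (\<lambda>u. \<forall>y\<in>?F. \<forall>z\<in>?F. y \<noteq> z \<longrightarrow> s y u \<noteq> s z u) (nhds u0)"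
  proof (intro eventually_ball_finite[OF finite_fibre] ballI)
    fix y z assume yz: "y \<in> ?F" "z \<in> ?F"
    show "eventually (\<lambda>u. y \<noteq> z \<longrightarrow> s y u \<noteq> s z u) (nhds u0)"
    proof (cases "y = z")
      case False
      obtain A B where AB: "open A" "open B" "y \<in> A" "z \<in> B" "A \<inter> B = {}"
        using hausdorff[OF False] by blast
      have "eventually (\<lambda>u. s y u \<in> A) (nhds u0)" "eventually (\<lambda>u. s z u \<in> B) (nhds u0)"
        using lim yz AB by (auto intro: topological_tendstoD)
      then show ?thesis by eventually_elim (use AB(5) in auto)
    qed simp
  qed
  \<comment> \<open>The points outside all branch domains form a closed set, whose image is closed
    and misses \<open>u0\<close>; over the complement of that image every preimage lies in a branch
    domain.\<close>
  have "open (- T ` (- (\<Union>y\<in>?F. O' y)))"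
    using O'(1) by (intro open_Compl closed_map_T closed_Compl open_UN) auto
  moreover have "u0 \<in> - T ` (- (\<Union>y\<in>?F. O' y))" using O'(2) by auto
  ultimately have surj: "eventually (\<lambda>u. u \<in> - T ` (- (\<Union>y\<in>?F. O' y))) (nhds u0)"
    by (rule eventually_nhds_in_open)
  show ?thesis
  proof (rule that[OF lim])
    show "eventually (\<lambda>u. bij_betw (\<lambda>y. s y u) ?F (T -` {u})) (nhds u0)"
      using mem distinct surj
    proof eventually_elim
      case (elim u)
      show ?case
      proof (rule bij_betw_imageI)
        show "inj_on (\<lambda>y. s y u) ?F" using elim(2) unfolding inj_on_def by blast
        show "(\<lambda>y. s y u) ` ?F = T -` {u}"
        proof (intro equalityI subsetI)
          fix z assume z: "z \<in> T -` {u}"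
          then obtain y where "y \<in> ?F" "z \<in> O' y" using elim(3) by blast
          then show "z \<in> (\<lambda>y. s y u) ` ?F" using s_eq[of z y] z by (intro image_eqI[of _ _ y]) auto
        qed (use elim(1) in auto)
      qed
    qed
  qed
qed

text \<open>Inverse branches turn the sum over a moving fibre into one over a fixed finite fibre.
  The base map \<open>\<phi>\<close> will be the identity for transfer operators and the iterate
  itself for sums over the classes of a level of the tail relation.\<close>

lemma continuous_on_fibre_sum:
  fixes f :: "'c::topological_space \<times> 'a \<Rightarrow> 'b::topological_comm_monoid_add"
  assumes \<phi>: "continuous_on UNIV \<phi>" and f: "continuous_on {(x, y). T y = \<phi> x} f"
  shows "continuous_on UNIV (\<lambda>x. \<Sum>y\<in>T -` {\<phi> x}. f (x, y))"
  unfolding continuous_on_def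
proof
  fix x0
  obtain s where s: "\<And>y. T y = \<phi> x0 \<Longrightarrow> (s y \<longlongrightarrow> y) (nhds (\<phi> x0))"
    and bij: "eventually (\<lambda>u. bij_betw (\<lambda>y. s y u) (T -` {\<phi> x0}) (T -` {u})) (nhds (\<phi> x0))"
    using fibre_sections[of "\<phi> x0"] by blast
  have lim\<phi>: "filterlim \<phi> (nhds (\<phi> x0)) (at x0)"
    using \<phi> by (simp add: continuous_on_def)
  have bij': "eventually (\<lambda>x. bij_betw (\<lambda>y. s y (\<phi> x)) (T -` {\<phi> x0}) (T -` {\<phi> x})) (at x0)"
    using eventually_compose_filterlim[OF bij lim\<phi>] .
  have "((\<lambda>x. \<Sum>y\<in>T -` {\<phi> x0}. f (x, s y (\<phi> x))) \<longlongrightarrow> (\<Sum>y\<in>T -` {\<phi> x0}. f (x0, y))) (at x0)"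
  proof (rule tendsto_sum)
    fix y assume y: "y \<in> T -` {\<phi> x0}"
    show "((\<lambda>x. f (x, s y (\<phi> x))) \<longlongrightarrow> f (x0, y)) (at x0)"
    proof (rule continuous_on_tendsto_compose[OF f])
      show "((\<lambda>x. (x, s y (\<phi> x))) \<longlongrightarrow> (x0, y)) (at x0)"
        using filterlim_compose[OF s lim\<phi>, of y] y by (intro tendsto_intros) auto
      show "eventually (\<lambda>x. (x, s y (\<phi> x)) \<in> {(x, y). T y = \<phi> x}) (at x0)"
        using bij' by eventually_elim (use y in \<open>auto dest: bij_betwE\<close>)
    qed (use y in auto)
  qed
  moreover have "eventually (\<lambda>x. (\<Sum>y\<in>T -` {\<phi> x0}. f (x, s y (\<phi> x))) = (\<Sum>y\<in>T -` {\<phi> x}. f (x, y))) (at x0)"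
    using bij' by eventually_elim (rule sum.reindex_bij_betw)
  ultimately show "((\<lambda>x. \<Sum>y\<in>T -` {\<phi> x}. f (x, y)) \<longlongrightarrow> (\<Sum>y\<in>T -` {\<phi> x0}. f (x0, y))) (at x0)"
    by (rule Lim_transform_eventually)
qed

end

lemma orbit_prod_add: "orbit_prod h S (m + n) x = orbit_prod h S n x * orbit_prod h S m ((S ^^ n) x)"
proof -
  have "orbit_prod h S (m + n) x = (\<Prod>j<n. h ((S ^^ j) x)) * (\<Prod>j\<in>{n..<n+m}. h ((S ^^ j) x))"
    unfolding orbit_prod_def lessThan_atLeast0
    by (subst prod.atLeastLessThan_concat) (auto simp: add.commute)
  also have "(\<Prod>j\<in>{n..<n+m}. h ((S ^^ j) x)) = (\<Prod>j<m. h ((S ^^ (j + n)) x))"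
    using prod.shift_bounds_nat_ivl[of "\<lambda>j. h ((S ^^ j) x)" 0 n m]
    by (simp add: lessThan_atLeast0 add.commute)
  finally show ?thesis by (simp add: orbit_prod_def funpow_add)
qed

lemma local_homeomorphism_imp_compact_local_homeo:
  fixes T :: "'a::t2_space \<Rightarrow> 'a"
  assumes "compact (UNIV :: 'a set)" "local_homeomorphism T"
  shows "compact_local_homeo T"
proof
  have lh: "\<exists>U h. open U \<and> x \<in> U \<and> open (T ` U) \<and> homeomorphism U (T ` U) T h" for x
    using assms(2) by (simp add: local_homeomorphism_def)
  show "continuous_on UNIV T"
    unfolding continuous_on_eq_continuous_at[OF open_UNIV]
    using lh by (metis continuous_on_eq_continuous_at homeomorphism_def)
  show "\<exists>U. open U \<and> x \<in> U \<and> inj_on T U" for x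
    using lh[of x] unfolding homeomorphism_def by (metis inj_on_inverseI)
  show "open (T ` U)" if "open U" for U
  proof (rule topological_space_class.openI)
    fix y assume "y \<in> T ` U"
    then obtain x where x: "x \<in> U" "y = T x" by blast
    obtain V h where V: "open V" "x \<in> V" "open (T ` V)" "homeomorphism V (T ` V) T h"
      using lh by blast
    have "openin (top_of_set (T ` V)) (T ` (V \<inter> U))"
      using homeomorphism_imp_open_map[OF V(4)] \<open>open U\<close> by (metis openin_open_Int)
    then have "open (T ` (V \<inter> U))" using V(3) openin_open_trans by blast
    then show "\<exists>S. open S \<and> y \<in> S \<and> S \<subseteq> T ` U"
      using x V(2) by (intro exI[of _ "T ` (V \<inter> U)"]) auto
  qed
qed fact

section \<open>Transfer operators and normalised averages\<close>

locale weighted_local_homeo = compact_local_homeo T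
  for T :: "'a::t2_space \<Rightarrow> 'a" +
  fixes g :: "'a \<Rightarrow> real"
  assumes surj_T: "surj T" and continuous_g: "continuous_on UNIV g" and g_pos: "g x > 0"
begin

text \<open>The n-th iterate of the Ruelle transfer operator with weight \<open>g\<close>, see
  \<open>transfer_add\<close>. Vector values cover both real functions and complex fibre
  sums.\<close>

definition transfer :: "nat \<Rightarrow> ('a \<Rightarrow> 'b::real_normed_vector) \<Rightarrow> 'a \<Rightarrow> 'b" where
  "transfer n f u = (\<Sum>z\<in>(T ^^ n) -` {u}. orbit_prod g T n z *\<^sub>R f z)"

text \<open>The average E_n of the overview; its value depends on \<open>x\<close> only through
  \<open>(T ^^ n) x\<close>.\<close>

definition cond_exp :: "nat \<Rightarrow> ('a \<Rightarrow> 'b::real_normed_vector) \<Rightarrow> 'a \<Rightarrow> 'b" where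
  "cond_exp n f x = transfer n f ((T ^^ n) x) /\<^sub>R transfer n (\<lambda>_. 1) ((T ^^ n) x)"

lemma continuous_funpow: "continuous_on A (T ^^ n)"
  using compact_local_homeo.continuous_T[OF funpow] continuous_on_subset by blast

lemma finite_funpow_fibre: "finite ((T ^^ n) -` {u})"
  using compact_local_homeo.finite_fibre[OF funpow] .

lemma orbit_prod_pos: "orbit_prod g T n x > 0"
  unfolding orbit_prod_def by (intro prod_pos ballI g_pos)

lemma continuous_orbit_prod: "continuous_on A (orbit_prod g T n)"
  unfolding orbit_prod_def[abs_def]
  by (intro continuous_intros continuous_on_compose2[OF continuous_g continuous_funpow]) auto

lemma continuous_transfer:
  assumes "continuous_on UNIV f"
  shows "continuous_on UNIV (transfer n f)"
proof -
  interpret Tn: compact_local_homeo "T ^^ n" by (rule funpow)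
  have "continuous_on UNIV (\<lambda>p :: 'a \<times> 'a. orbit_prod g T n (snd p) *\<^sub>R f (snd p))"
    by (rule continuous_on_compose2[where g = "\<lambda>z. orbit_prod g T n z *\<^sub>R f z" and t = UNIV])
      (auto intro!: continuous_on_scaleR continuous_orbit_prod assms continuous_on_snd continuous_on_id)
  then have "continuous_on {(x, y). (T ^^ n) y = x} (\<lambda>p. orbit_prod g T n (snd p) *\<^sub>R f (snd p))"
    by (rule continuous_on_subset) simp
  from Tn.continuous_on_fibre_sum[OF continuous_on_id this] show ?thesis
    by (simp add: transfer_def[abs_def])
qed

lemma transfer_one_pos: "transfer n (\<lambda>_. 1 :: real) u > 0"
proof -
  have "surj (T ^^ n)" using surj_T by (rule surj_fn)
  from surjD[OF this, of u] have "(T ^^ n) -` {u} \<noteq> {}" by auto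
  then show ?thesis
    unfolding transfer_def by (intro sum_pos finite_funpow_fibre) (simp_all add: orbit_prod_pos)
qed

text \<open>The fibre of \<open>T ^^ (m + n)\<close> splits into fibres of \<open>T ^^ n\<close>
  over the points of a fibre of \<open>T ^^ m\<close>, and the weights split by the cocycle identity
  \<open>orbit_prod_add\<close>.\<close>

lemma transfer_add: "transfer (m + n) f = transfer m (transfer n f)"
proof
  fix u
  have eq: "(T ^^ (m + n)) -` {u} = (\<Union>a\<in>(T ^^ m) -` {u}. (T ^^ n) -` {a})"
    by (auto simp: funpow_add)
  have "transfer (m + n) f u = (\<Sum>a\<in>(T ^^ m) -` {u}. \<Sum>z\<in>(T ^^ n) -` {a}. orbit_prod g T (m + n) z *\<^sub>R f z)"
    unfolding transfer_def eq
    by (rule sum.UNION_disjoint) (auto simp: finite_funpow_fibre)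
  also have "\<dots> = transfer m (transfer n f) u"
    unfolding transfer_def scaleR_sum_right
    by (intro sum.cong refl) (auto simp: orbit_prod_add mult.commute)
  finally show "transfer (m + n) f u = transfer m (transfer n f) u" .
qed

lemma continuous_cond_exp:
  assumes "continuous_on UNIV f"
  shows "continuous_on UNIV (cond_exp n f)"
proof -
  have "continuous_on UNIV (\<lambda>u. transfer n f u /\<^sub>R transfer n (\<lambda>_. 1) u)"
    by (intro continuous_intros continuous_transfer assms) (use transfer_one_pos in \<open>auto simp: less_imp_neq[symmetric]\<close>)
  from continuous_on_compose2[OF this continuous_funpow] show ?thesis
    unfolding cond_exp_def[abs_def] by auto
qed

lemma transfer_mono: "(\<And>x. f x \<le> f' x) \<Longrightarrow> transfer n f u \<le> transfer n f' u" for f f' :: "'a \<Rightarrow> real"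
  unfolding transfer_def
  by (intro sum_mono) (simp add: mult_left_mono less_imp_le[OF orbit_prod_pos])

text \<open>The normalising factor is constant on the fibre. Reading it off at \<open>z\<close>
  rather than at \<open>x\<close> makes the weight a function of \<open>z\<close> alone, which can
  enter a test function on the tail relation.\<close>

lemma cond_exp_eq_sum:
  "cond_exp n f x = (\<Sum>z\<in>(T ^^ n) -` {(T ^^ n) x}.
     (orbit_prod g T n z / transfer n (\<lambda>_. 1) ((T ^^ n) z)) *\<^sub>R f z)"
  unfolding cond_exp_def transfer_def[of n f] scaleR_sum_right
  by (intro sum.cong refl) (auto simp: field_simps)

lemma transfer_const: "transfer n (\<lambda>_. c) u = transfer n (\<lambda>_. 1) u * c" for c :: real
  by (simp add: transfer_def sum_distrib_right)

lemma cond_exp_const: "cond_exp n (\<lambda>_. c) x = c" for c :: real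
  unfolding cond_exp_def transfer_const[of n c] using transfer_one_pos[of n "(T ^^ n) x"] by simp

lemma transfer_plus: "transfer n (\<lambda>x. f x + f' x) u = transfer n f u + transfer n f' u"
  by (simp add: transfer_def scaleR_add_right sum.distrib)

lemma cond_exp_plus: "cond_exp n (\<lambda>x. f x + f' x) u = cond_exp n f u + cond_exp n f' u"
  by (simp add: cond_exp_def transfer_plus scaleR_add_right)

lemma cond_exp_mono: "(\<And>x. f x \<le> f' x) \<Longrightarrow> cond_exp n f u \<le> cond_exp n f' u" for f f' :: "'a \<Rightarrow> real"
  unfolding cond_exp_def using transfer_one_pos[of n "(T ^^ n) u"]
  by (simp add: mult_left_mono transfer_mono)

text \<open>The tower property. Since \<open>cond_exp n f\<close> is constant on fibres of
  \<open>T ^^ n\<close>, applying \<open>transfer n\<close> to it multiplies by the normalisation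
  and returns \<open>transfer n f\<close>; the remaining m - n steps see no difference.\<close>

lemma cond_exp_cond_exp:
  assumes "n \<le> m"
  shows "cond_exp m (cond_exp n f) = cond_exp m f"
proof -
  obtain k where m: "m = k + n" using assms by (metis le_Suc_ex add.commute)
  have "transfer n (cond_exp n f) u = transfer n f u" for u
  proof -
    have "transfer n (cond_exp n f) u = (\<Sum>z\<in>(T ^^ n) -` {u}. orbit_prod g T n z *\<^sub>R (transfer n f u /\<^sub>R transfer n (\<lambda>_. 1) u))"
      unfolding transfer_def[of n "cond_exp n f"] by (intro sum.cong refl) (auto simp: cond_exp_def)
    also have "\<dots> = transfer n (\<lambda>_. 1) u *\<^sub>R (transfer n f u /\<^sub>R transfer n (\<lambda>_. 1) u)"
      by (simp only: transfer_def[of n "\<lambda>_. 1"] real_scaleR_def mult_1_right scaleR_sum_left)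
    finally show ?thesis using transfer_one_pos[of n u] by simp
  qed
  then have "transfer n (cond_exp n f) = transfer n f" ..
  then show ?thesis by (intro ext) (simp add: cond_exp_def m transfer_add)
qed

end

section \<open>Quasi-invariance and invariance under conditional expectations\<close>

lemma tail_rel_level_mono: "m \<le> n \<Longrightarrow> tail_rel_level T m \<subseteq> tail_rel_level T n"
proof
  fix p assume mn: "m \<le> n" and p: "p \<in> tail_rel_level T m"
  obtain k where "n = k + m" using mn by (metis le_Suc_ex add.commute)
  then show "p \<in> tail_rel_level T n" using p by (auto simp: tail_rel_level_def funpow_add)
qed

lemma tail_rel_level_sym: "(x, y) \<in> tail_rel_level T n \<longleftrightarrow> (y, x) \<in> tail_rel_level T n"
  by (auto simp: tail_rel_level_def)

lemma tail_rel_sym: "(x, y) \<in> tail_rel T \<longleftrightarrow> (y, x) \<in> tail_rel T"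
  using tail_rel_level_sym[of x y T] by (simp add: tail_rel_def)

lemma Cc_tail_continuous_on_level:
  assumes "f \<in> Cc_tail T"
  shows "continuous_on (tail_rel_level T n) f"
proof -
  have "continuous_map (top_of_set (tail_rel_level T n)) (tail_topology T) id"
    unfolding continuous_map
  proof (intro conjI allI impI)
    fix W assume "openin (tail_topology T) W"
    then have "openin (top_of_set (tail_rel_level T n)) (W \<inter> tail_rel_level T n)"
      by (simp add: openin_tail_topology)
    then show "openin (top_of_set (tail_rel_level T n))
        {x \<in> topspace (top_of_set (tail_rel_level T n)). id x \<in> W}"
      by (simp add: Int_def conj_commute)
  qed (auto simp: topspace_tail_topology tail_rel_def)
  then have "continuous_map (top_of_set (tail_rel_level T n)) euclidean (f \<circ> id)"
    using assms by (intro continuous_map_compose) (auto simp: Cc_tail_def)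
  then show ?thesis by simp
qed

context compact_local_homeo
begin

lemma closed_tail_rel_level: "closed (tail_rel_level T n)"
proof -
  interpret Tn: compact_local_homeo "T ^^ n" by (rule funpow)
  have "closed {p. (T ^^ n) (fst p) = (T ^^ n) (snd p)}"
    by (intro closed_Collect_eq continuous_on_compose2[OF Tn.continuous_T]
        continuous_on_fst continuous_on_snd continuous_on_id) auto
  then show ?thesis by (simp add: tail_rel_level_def case_prod_unfold)
qed

text \<open>For \<open>m = k + n\<close> the map \<open>T ^^ k\<close> is injective near the common
  point \<open>(T ^^ n) x = (T ^^ n) y\<close>, so pairs of level \<open>m\<close> close to a pair
  of level \<open>n\<close> already belong to level \<open>n\<close>.\<close>

lemma openin_tail_rel_level: "openin (tail_topology T) (tail_rel_level T n)"
  unfolding openin_tail_topology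
proof (intro conjI allI)
  fix m
  show "openin (top_of_set (tail_rel_level T m)) (tail_rel_level T n \<inter> tail_rel_level T m)"
  proof (cases "m \<le> n")
    case True
    then show ?thesis using tail_rel_level_mono[OF True, of T] by (simp add: Int_absorb1)
  next
    case False
    then obtain k where m: "m = k + n" by (metis le_Suc_ex add.commute nat_le_linear)
    interpret Tn: compact_local_homeo "T ^^ n" by (rule funpow)
    interpret Tk: compact_local_homeo "T ^^ k" by (rule funpow)
    show ?thesis
    proof (subst openin_subopen, intro ballI)
      fix p assume p: "p \<in> tail_rel_level T n \<inter> tail_rel_level T m"
      obtain x y where xy: "p = (x, y)" by (cases p)
      obtain U where U: "open U" "(T ^^ n) x \<in> U" "inj_on (T ^^ k) U"
        using Tk.locally_inj_T by blast
      define W where "W = (T ^^ n) -` U"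
      have W: "open W" unfolding W_def using U(1) Tn.continuous_T by (rule open_vimage)
      have "openin (top_of_set (tail_rel_level T m)) (tail_rel_level T m \<inter> W \<times> W)"
        by (intro openin_open_Int open_Times W)
      moreover have "p \<in> tail_rel_level T m \<inter> W \<times> W"
        using p U(2) xy by (auto simp: W_def tail_rel_level_def)
      moreover have "tail_rel_level T m \<inter> W \<times> W \<subseteq> tail_rel_level T n \<inter> tail_rel_level T m"
        using U(3) by (auto simp: W_def tail_rel_level_def m funpow_add dest: inj_onD)
      ultimately show "\<exists>S. openin (top_of_set (tail_rel_level T m)) S \<and> p \<in> S \<and>
          S \<subseteq> tail_rel_level T n \<inter> tail_rel_level T m" by blast
    qed
  qed
qed (auto simp: tail_rel_def)

lemma closedin_tail_rel_level: "closedin (tail_topology T) (tail_rel_level T n)"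
  unfolding closedin_def topspace_tail_topology openin_tail_topology
proof (intro conjI allI)
  fix m
  have "(tail_rel T - tail_rel_level T n) \<inter> tail_rel_level T m = tail_rel_level T m \<inter> - tail_rel_level T n"
    by (auto simp: tail_rel_def)
  then show "openin (top_of_set (tail_rel_level T m)) ((tail_rel T - tail_rel_level T n) \<inter> tail_rel_level T m)"
    using openin_open_Int[OF open_Compl[OF closed_tail_rel_level]] by metis
qed (auto simp: tail_rel_def)

lemma subtopology_tail_rel_level:
  "subtopology (tail_topology T) (tail_rel_level T n) = top_of_set (tail_rel_level T n)"
  unfolding topology_eq
proof (intro allI iffI)
  fix W assume "openin (subtopology (tail_topology T) (tail_rel_level T n)) W"
  then show "openin (top_of_set (tail_rel_level T n)) W"
    by (auto simp: openin_subtopology openin_tail_topology)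
next
  fix W assume "openin (top_of_set (tail_rel_level T n)) W"
  then obtain O' where O': "open O'" "W = tail_rel_level T n \<inter> O'"
    by (auto simp: openin_open)
  have "openin (tail_topology T) (tail_rel T \<inter> O')"
    using O'(1) by (auto simp: openin_tail_topology tail_rel_def openin_open)
  then have "openin (subtopology (tail_topology T) (tail_rel_level T n)) ((tail_rel T \<inter> O') \<inter> tail_rel_level T n)"
    by (auto simp: openin_subtopology)
  moreover have "(tail_rel T \<inter> O') \<inter> tail_rel_level T n = W"
    using O'(2) by (auto simp: tail_rel_def)
  ultimately show "openin (subtopology (tail_topology T) (tail_rel_level T n)) W" by simp
qed

lemma compactin_tail_rel_level: "compactin (tail_topology T) (tail_rel_level T n)"
proof -
  have "compact (UNIV :: ('a \<times> 'a) set)"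
    using compact_Times[OF compact_UNIV compact_UNIV] by simp
  then have "compact (tail_rel_level T n)"
    using compact_Int_closed[OF _ closed_tail_rel_level] by (metis inf_top.left_neutral)
  then show ?thesis
    unfolding compactin_subspace subtopology_tail_rel_level topspace_tail_topology
    by (auto simp: tail_rel_def compact_space_subtopology)
qed

text \<open>The levels are open and increasing, so compactness places the support in a single
  one.\<close>

lemma Cc_tail_supported_level:
  assumes "f \<in> Cc_tail T"
  obtains n where "\<And>p. p \<in> tail_rel T \<Longrightarrow> f p \<noteq> 0 \<Longrightarrow> p \<in> tail_rel_level T n"
proof -
  define K where "K = tail_topology T closure_of {p \<in> tail_rel T. f p \<noteq> 0}"
  have K: "compactin (tail_topology T) K" using assms by (simp add: Cc_tail_def K_def)
  moreover have "K \<subseteq> \<Union>(range (tail_rel_level T))"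
    using compactin_subset_topspace[OF K] by (simp add: topspace_tail_topology tail_rel_def)
  ultimately obtain \<F> where \<F>: "finite \<F>" "\<F> \<subseteq> range (tail_rel_level T)" "K \<subseteq> \<Union>\<F>"
    unfolding compactin_def using openin_tail_rel_level by (metis (no_types, lifting) imageE)
  obtain N where N: "finite N" "\<F> = tail_rel_level T ` N"
    using finite_subset_image[OF \<F>(1,2)] by blast
  obtain n where n: "\<And>k. k \<in> N \<Longrightarrow> k \<le> n"
    using finite_nat_set_iff_bounded_le[of N] N(1) by blast
  show ?thesis
  proof (rule that[of n])
    fix p assume p: "p \<in> tail_rel T" "f p \<noteq> 0"
    have "{p \<in> tail_rel T. f p \<noteq> 0} \<subseteq> K"
      unfolding K_def by (intro closure_of_subset) (auto simp: topspace_tail_topology)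
    then have "p \<in> \<Union>\<F>" using p \<F>(3) by blast
    then show "p \<in> tail_rel_level T n" using N(2) tail_rel_level_mono[OF n] by blast
  qed
qed

text \<open>A level is open, closed and compact, so extension by zero keeps continuity and has
  compact support. This supplies the test functions.\<close>

lemma Cc_tail_extend_level:
  assumes "continuous_on (tail_rel_level T n) f"
  shows "(\<lambda>p. if p \<in> tail_rel_level T n then f p else 0) \<in> Cc_tail T" (is "?f \<in> _")
proof -
  have "continuous_map (tail_topology T) euclidean ?f"
    unfolding continuous_map
  proof (intro conjI allI impI)
    fix V :: "complex set" assume "openin euclidean V"
    then have V: "open V" by simp
    have "openin (subtopology (tail_topology T) (tail_rel_level T n)) (tail_rel_level T n \<inter> f -` V)"
      unfolding subtopology_tail_rel_level using assms V by (rule continuous_openin_preimage_gen)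
    then have 1: "openin (tail_topology T) (tail_rel_level T n \<inter> f -` V)"
      using openin_tail_rel_level openin_trans_full by blast
    have 2: "openin (tail_topology T) (tail_rel T - tail_rel_level T n)"
      using closedin_tail_rel_level[of n] by (simp add: closedin_def topspace_tail_topology)
    have "{x \<in> topspace (tail_topology T). ?f x \<in> V} =
        (tail_rel_level T n \<inter> f -` V) \<union> (if 0 \<in> V then tail_rel T - tail_rel_level T n else {})"
      by (auto simp: topspace_tail_topology tail_rel_def)
    then show "openin (tail_topology T) {x \<in> topspace (tail_topology T). ?f x \<in> V}"
      using 1 2 by auto
  qed auto
  moreover have "compactin (tail_topology T) (tail_topology T closure_of {p \<in> tail_rel T. ?f p \<noteq> 0})"
  proof (rule closed_compactin[OF compactin_tail_rel_level])
    show "tail_topology T closure_of {p \<in> tail_rel T. ?f p \<noteq> 0} \<subseteq> tail_rel_level T n"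
      by (rule closure_of_minimal[OF _ closedin_tail_rel_level]) (auto split: if_splits)
  qed (rule closedin_closure_of)
  ultimately show ?thesis by (simp add: Cc_tail_def)
qed

lemma infsum_tail_rel_eq_sum:
  fixes f :: "'a \<Rightarrow> 'b::{topological_comm_monoid_add, t2_space}"
  assumes "\<And>y. (x, y) \<in> tail_rel T \<Longrightarrow> f y \<noteq> 0 \<Longrightarrow> (x, y) \<in> tail_rel_level T n"
  shows "(\<Sum>\<^sub>\<infinity>y\<in>{y. (x, y) \<in> tail_rel T}. f y) = (\<Sum>y\<in>(T ^^ n) -` {(T ^^ n) x}. f y)"
    and "(\<Sum>\<^sub>\<infinity>y\<in>{y. (y, x) \<in> tail_rel T}. f y) = (\<Sum>y\<in>(T ^^ n) -` {(T ^^ n) x}. f y)"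
proof -
  interpret Tn: compact_local_homeo "T ^^ n" by (rule funpow)
  have "(\<Sum>\<^sub>\<infinity>y\<in>{y. (x, y) \<in> tail_rel T}. f y) = (\<Sum>\<^sub>\<infinity>y\<in>(T ^^ n) -` {(T ^^ n) x}. f y)"
  proof (rule infsum_cong_neutral)
    show "f y = 0" if "y \<in> {y. (x, y) \<in> tail_rel T} - (T ^^ n) -` {(T ^^ n) x}" for y
      by (rule ccontr) (use that assms[of y] in \<open>auto simp: tail_rel_level_def\<close>)
    show "f y = 0" if "y \<in> (T ^^ n) -` {(T ^^ n) x} - {y. (x, y) \<in> tail_rel T}" for y
      using that by (auto simp: tail_rel_def tail_rel_level_def dest: spec[of _ n])
  qed simp
  then show 1: "(\<Sum>\<^sub>\<infinity>y\<in>{y. (x, y) \<in> tail_rel T}. f y) = (\<Sum>y\<in>(T ^^ n) -` {(T ^^ n) x}. f y)"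
    by (simp add: Tn.finite_fibre)
  have "{y. (y, x) \<in> tail_rel T} = {y. (x, y) \<in> tail_rel T}"
    using tail_rel_sym[of _ x T] by auto
  then show "(\<Sum>\<^sub>\<infinity>y\<in>{y. (y, x) \<in> tail_rel T}. f y) = (\<Sum>y\<in>(T ^^ n) -` {(T ^^ n) x}. f y)"
    using 1 by simp
qed

end

section \<open>Quasi-invariance as invariance under the averages\<close>

lemma integrable_continuous_compact:
  fixes f :: "'a::topological_space \<Rightarrow> 'b::{banach, second_countable_topology}"
  assumes "compact (UNIV :: 'a set)" "sets \<mu> = sets borel" "prob_space \<mu>" "continuous_on UNIV f"
  shows "integrable \<mu> f"
proof -
  interpret prob_space \<mu> by fact
  have "bounded (range f)"
    using compact_continuous_image[OF assms(4,1)] by (rule compact_imp_bounded)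
  then obtain B where B: "\<And>x. norm (f x) \<le> B" unfolding bounded_iff by auto
  have "f \<in> borel_measurable \<mu>"
    using borel_measurable_continuous_onI[OF assms(4)] measurable_cong_sets[OF assms(2) refl] by blast
  then show ?thesis using B by (intro integrable_const_bound[where B = B]) auto
qed

context weighted_local_homeo
begin

definition cond_exp_invariant :: "'a measure \<Rightarrow> bool" where
  "cond_exp_invariant \<mu> \<longleftrightarrow>
     (\<forall>n (f :: 'a \<Rightarrow> real). continuous_on UNIV f \<longrightarrow> integral\<^sup>L \<mu> (cond_exp n f) = integral\<^sup>L \<mu> f)"

text \<open>On level \<open>n\<close> take the test function \<phi>(x) w(y), where \<open>w\<close>
  is the normalised weight of the average. Summing over \<open>y\<close> gives \<phi>(x), since the
  weights add up to 1 on a fibre. Multiplying by the cocycle replaces w(y) by w(x), so summing over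
  \<open>x\<close> gives \<open>cond_exp n \<phi> y\<close>.\<close>

lemma quasi_invariant_imp_cond_exp_invariant:
  assumes qi: "quasi_invariant_RN T (stationary_cocycle g T) \<mu>"
  shows "cond_exp_invariant \<mu>"
  unfolding cond_exp_invariant_def
proof (intro allI impI)
  fix n and \<phi> :: "'a \<Rightarrow> real" assume \<phi>: "continuous_on UNIV \<phi>"
  define w where "w z = orbit_prod g T n z / transfer n (\<lambda>_. 1) ((T ^^ n) z)" for z
  have "continuous_on UNIV (\<lambda>x. transfer n (\<lambda>_. 1) ((T ^^ n) x) :: real)"
    by (rule continuous_on_compose2[OF continuous_transfer continuous_funpow]) auto
  then have w: "continuous_on UNIV w"
    unfolding w_def[abs_def] using transfer_one_pos
    by (intro continuous_on_divide continuous_orbit_prod) (auto simp: less_imp_neq[symmetric])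
  define f where "f p = (if p \<in> tail_rel_level T n then complex_of_real (\<phi> (fst p) * w (snd p)) else 0)" for p
  have "f \<in> Cc_tail T"
    unfolding f_def[abs_def]
  proof (rule Cc_tail_extend_level)
    show "continuous_on (tail_rel_level T n) (\<lambda>p. complex_of_real (\<phi> (fst p) * w (snd p)))"
      by (intro continuous_on_of_real continuous_on_mult continuous_on_compose2[OF \<phi>]
          continuous_on_compose2[OF w] continuous_on_fst continuous_on_snd continuous_on_id) auto
  qed
  then have "(\<integral>x. (\<Sum>\<^sub>\<infinity>y\<in>{y. (x, y) \<in> tail_rel T}. f (x, y)) \<partial>\<mu>) =
     (\<integral>y. (\<Sum>\<^sub>\<infinity>x\<in>{x. (x, y) \<in> tail_rel T}. f (x, y) * complex_of_real (stationary_cocycle g T (x, y))) \<partial>\<mu>)"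
    using qi unfolding quasi_invariant_RN_def by blast
  moreover have "(\<Sum>\<^sub>\<infinity>y\<in>{y. (x, y) \<in> tail_rel T}. f (x, y)) = complex_of_real (\<phi> x)" for x
  proof -
    have "(\<Sum>\<^sub>\<infinity>y\<in>{y. (x, y) \<in> tail_rel T}. f (x, y)) = (\<Sum>y\<in>(T ^^ n) -` {(T ^^ n) x}. f (x, y))"
      by (rule infsum_tail_rel_eq_sum) (auto simp: f_def split: if_splits)
    also have "\<dots> = (\<Sum>y\<in>(T ^^ n) -` {(T ^^ n) x}. complex_of_real (\<phi> x * w y))"
      by (intro sum.cong) (auto simp: f_def tail_rel_level_def)
    also have "\<dots> = complex_of_real (\<phi> x * cond_exp n (\<lambda>_. 1) x)"
      by (simp add: cond_exp_eq_sum w_def sum_distrib_left)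
    finally show ?thesis by (simp add: cond_exp_const)
  qed
  moreover have "(\<Sum>\<^sub>\<infinity>x\<in>{x. (x, y) \<in> tail_rel T}. f (x, y) * complex_of_real (stationary_cocycle g T (x, y))) =
      complex_of_real (cond_exp n \<phi> y)" for y
  proof -
    have "(\<Sum>\<^sub>\<infinity>x\<in>{x. (x, y) \<in> tail_rel T}. f (x, y) * complex_of_real (stationary_cocycle g T (x, y))) =
        (\<Sum>x\<in>(T ^^ n) -` {(T ^^ n) y}. f (x, y) * complex_of_real (stationary_cocycle g T (x, y)))"
      by (rule infsum_tail_rel_eq_sum) (auto simp: f_def tail_rel_level_def split: if_splits)
    also have "\<dots> = (\<Sum>x\<in>(T ^^ n) -` {(T ^^ n) y}. complex_of_real (w x * \<phi> x))"
    proof (intro sum.cong refl)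
      fix x assume "x \<in> (T ^^ n) -` {(T ^^ n) y}"
      then have eq: "(T ^^ n) x = (T ^^ n) y" by simp
      then show "f (x, y) * complex_of_real (stationary_cocycle g T (x, y)) = complex_of_real (w x * \<phi> x)"
        unfolding stationary_cocycle_eq[OF g_pos eq]
        using orbit_prod_pos[of n y] by (simp add: f_def tail_rel_level_def w_def)
    qed
    finally show ?thesis by (simp add: cond_exp_eq_sum w_def)
  qed
  ultimately show "integral\<^sup>L \<mu> (cond_exp n \<phi>) = integral\<^sup>L \<mu> \<phi>" by simp
qed

text \<open>A test function lives on some level \<open>n\<close>, where both sides are integrals of
  continuous fibre sums \<open>F\<close> and \<open>G\<close>. Their averages over fibres of
  \<open>T ^^ n\<close> agree by exchanging the two summations, because \<open>h (x, y)\<close>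
  converts the weight of \<open>y\<close> into that of \<open>x\<close>; invariance then gives equal
  integrals.\<close>

lemma cond_exp_invariant_imp_quasi_invariant:
  assumes \<mu>: "sets \<mu> = sets borel" "prob_space \<mu>" and inv: "cond_exp_invariant \<mu>"
  shows "quasi_invariant_RN T (stationary_cocycle g T) \<mu>"
  unfolding quasi_invariant_RN_def
proof
  fix f assume f: "f \<in> Cc_tail T"
  obtain n where n: "\<And>p. p \<in> tail_rel T \<Longrightarrow> f p \<noteq> 0 \<Longrightarrow> p \<in> tail_rel_level T n"
    using Cc_tail_supported_level[OF f] by blast
  interpret Tn: compact_local_homeo "T ^^ n" by (rule funpow)
  define h where "h p = complex_of_real (orbit_prod g T n (fst p) / orbit_prod g T n (snd p))" for p
  define F where "F x = (\<Sum>y\<in>(T ^^ n) -` {(T ^^ n) x}. f (x, y))" for x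
  define G where "G y = (\<Sum>x\<in>(T ^^ n) -` {(T ^^ n) y}. f (x, y) * h (x, y))" for y
  have level: "tail_rel_level T n = {(x, y). (T ^^ n) y = (T ^^ n) x}"
    by (auto simp: tail_rel_level_def)
  have fc: "continuous_on {(x, y). (T ^^ n) y = (T ^^ n) x} f"
    using Cc_tail_continuous_on_level[OF f, of n] unfolding level .
  then have F: "continuous_on UNIV F"
    unfolding F_def[abs_def] by (intro Tn.continuous_on_fibre_sum Tn.continuous_T)
  have h: "continuous_on A h" for A
    unfolding h_def[abs_def] using orbit_prod_pos[of n]
    by (intro continuous_on_of_real continuous_on_divide continuous_on_compose2[OF continuous_orbit_prod[of UNIV]]
          continuous_on_fst continuous_on_snd continuous_on_id) (auto simp: less_imp_neq[symmetric])
  \<comment> \<open>\<open>G\<close> sums over the first coordinate, so the pair is swapped to fit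
    \<open>continuous_on_fibre_sum\<close>.\<close>
  have "continuous_on {(x, y). (T ^^ n) y = (T ^^ n) x} (\<lambda>p. (\<lambda>p. f p * h p) (prod.swap p))"
    by (rule continuous_on_compose2[where t = "{(x, y). (T ^^ n) y = (T ^^ n) x}"])
      (auto intro!: continuous_on_mult fc h continuous_on_swap)
  from Tn.continuous_on_fibre_sum[OF Tn.continuous_T this] have G: "continuous_on UNIV G"
    unfolding G_def[abs_def] by simp
  have FG: "cond_exp n F z = cond_exp n G z" for z
  proof -
    let ?A = "(T ^^ n) -` {(T ^^ n) z}"
    define L where "L = (transfer n (\<lambda>_. 1) ((T ^^ n) z) :: real)"
    have "cond_exp n F z = (\<Sum>x\<in>?A. \<Sum>y\<in>?A. (orbit_prod g T n x / L) *\<^sub>R f (x, y))"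
      unfolding cond_exp_eq_sum scaleR_sum_right[symmetric] L_def
      by (intro sum.cong refl arg_cong2[of _ _ _ _ "(*\<^sub>R)"]) (auto simp: F_def)
    also have "\<dots> = (\<Sum>y\<in>?A. \<Sum>x\<in>?A. (orbit_prod g T n x / L) *\<^sub>R f (x, y))"
      by (rule sum.swap)
    also have "\<dots> = (\<Sum>y\<in>?A. (orbit_prod g T n y / L) *\<^sub>R G y)"
      unfolding G_def scaleR_sum_right
    proof (intro sum.cong refl)
      fix y x assume "y \<in> ?A"
      show "(orbit_prod g T n x / L) *\<^sub>R f (x, y) = (orbit_prod g T n y / L) *\<^sub>R (f (x, y) * h (x, y))"
        using orbit_prod_pos[of n y] by (simp add: h_def scaleR_conv_of_real)
    qed auto
    also have "\<dots> = cond_exp n G z"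
      unfolding cond_exp_eq_sum L_def by (intro sum.cong) auto
    finally show ?thesis .
  qed
  \<comment> \<open>\<open>cond_exp_invariant\<close> speaks of real functions; complex ones are
    split into real and imaginary parts.\<close>
  have inv': "integral\<^sup>L \<mu> (cond_exp n H) = integral\<^sup>L \<mu> H" if H: "continuous_on UNIV H" for H :: "'a \<Rightarrow> complex"
  proof -
    have i: "integrable \<mu> H" "integrable \<mu> (cond_exp n H)"
      using H by (auto intro!: integrable_continuous_compact[OF compact_UNIV \<mu>] continuous_cond_exp)
    have Re: "Re (cond_exp n H x) = cond_exp n (\<lambda>x. Re (H x)) x"
      and Im: "Im (cond_exp n H x) = cond_exp n (\<lambda>x. Im (H x)) x" for x
      by (simp_all add: cond_exp_eq_sum)
    show ?thesis
    proof (rule complex_eqI)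
      have "continuous_on UNIV (\<lambda>x. Re (H x))" "continuous_on UNIV (\<lambda>x. Im (H x))"
        using H by (auto intro: continuous_intros)
      then show "Re (integral\<^sup>L \<mu> (cond_exp n H)) = Re (integral\<^sup>L \<mu> H)"
        "Im (integral\<^sup>L \<mu> (cond_exp n H)) = Im (integral\<^sup>L \<mu> H)"
        using inv unfolding cond_exp_invariant_def
        by (simp_all add: integral_Re[OF i(1), symmetric] integral_Re[OF i(2), symmetric]
            integral_Im[OF i(1), symmetric] integral_Im[OF i(2), symmetric] Re Im)
    qed
  qed
  have "(\<integral>x. (\<Sum>\<^sub>\<infinity>y\<in>{y. (x, y) \<in> tail_rel T}. f (x, y)) \<partial>\<mu>) = integral\<^sup>L \<mu> F"
  proof (rule Bochner_Integration.integral_cong[OF refl])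
    show "(\<Sum>\<^sub>\<infinity>y\<in>{y. (x, y) \<in> tail_rel T}. f (x, y)) = F x" for x
      unfolding F_def by (rule infsum_tail_rel_eq_sum) (use n in auto)
  qed
  also have "\<dots> = integral\<^sup>L \<mu> G" using inv'[OF F] inv'[OF G] FG by (metis ext)
  also have "\<dots> = (\<integral>y. (\<Sum>\<^sub>\<infinity>x\<in>{x. (x, y) \<in> tail_rel T}. f (x, y) * complex_of_real (stationary_cocycle g T (x, y))) \<partial>\<mu>)"
  proof (rule Bochner_Integration.integral_cong[OF refl])
    fix y
    have "(\<Sum>\<^sub>\<infinity>x\<in>{x. (x, y) \<in> tail_rel T}. f (x, y) * complex_of_real (stationary_cocycle g T (x, y))) =
      (\<Sum>x\<in>(T ^^ n) -` {(T ^^ n) y}. f (x, y) * complex_of_real (stationary_cocycle g T (x, y)))"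
      by (rule infsum_tail_rel_eq_sum)
        (use n tail_rel_sym[of _ y T] tail_rel_level_sym[of _ y T n] in auto)
    also have "\<dots> = G y"
      unfolding G_def h_def by (intro sum.cong refl) (simp add: stationary_cocycle_eq[OF g_pos])
    finally show "G y = (\<Sum>\<^sub>\<infinity>x\<in>{x. (x, y) \<in> tail_rel T}. f (x, y) * complex_of_real (stationary_cocycle g T (x, y)))" ..
  qed
  finally show "(\<integral>x. (\<Sum>\<^sub>\<infinity>y\<in>{y. (x, y) \<in> tail_rel T}. f (x, y)) \<partial>\<mu>) =
    (\<integral>y. (\<Sum>\<^sub>\<infinity>x\<in>{x. (x, y) \<in> tail_rel T}. f (x, y) * complex_of_real (stationary_cocycle g T (x, y))) \<partial>\<mu>)" .
qed

section \<open>Existence of an invariant probability measure\<close>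

lemma ex_cond_exp_pmf:
  "\<exists>P :: 'a pmf. \<forall>f :: 'a \<Rightarrow> real. measure_pmf.expectation P f = cond_exp n f x"
proof -
  let ?A = "(T ^^ n) -` {(T ^^ n) x}"
  define w where "w z = (if z \<in> ?A then orbit_prod g T n z / transfer n (\<lambda>_. 1) ((T ^^ n) z) else 0)" for z
  have w0: "w z \<ge> 0" for z
    by (auto simp: w_def intro!: divide_nonneg_pos less_imp_le[OF orbit_prod_pos] transfer_one_pos)
  \<comment> \<open>The weights add up to the average of the constant function 1.\<close>
  have sum: "(\<Sum>z\<in>?A. w z) = 1"
    using cond_exp_eq_sum[of n "\<lambda>_. 1 :: real" x] by (simp add: cond_exp_const w_def)
  have "(\<integral>\<^sup>+z. ennreal (w z) \<partial>count_space UNIV) = (\<Sum>z\<in>?A. ennreal (w z))"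
    by (rule nn_integral_count_space') (auto simp: w_def finite_funpow_fibre)
  also have "\<dots> = 1" using sum w0 by (simp add: sum_ennreal)
  finally have pmf: "pmf (embed_pmf w) z = w z" for z using w0 by (intro pmf_embed_pmf)
  have "measure_pmf.expectation (embed_pmf w) f = cond_exp n f x" for f :: "'a \<Rightarrow> real"
  proof -
    have "measure_pmf.expectation (embed_pmf w) f = (\<Sum>z\<in>?A. f z * pmf (embed_pmf w) z)"
      by (rule integral_measure_pmf_real) (auto simp: finite_funpow_fibre set_pmf_iff pmf w_def split: if_splits)
    also have "\<dots> = cond_exp n f x"
      unfolding cond_exp_eq_sum pmf by (intro sum.cong refl) (simp add: w_def)
    finally show ?thesis .
  qed
  then show ?thesis by blast
qed

end

text \<open>The averages at a fixed base point, the arbitrary \<open>undefined\<close>, are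
  expectations of finitely supported measures and converge weakly along a subsequence
  \<open>r\<close>. As soon as r k \<ge> n, the tower property gives \<open>cond_exp n f\<close> and
  \<open>f\<close> the same expectation, and both are continuous, so equality survives in the
  limit.\<close>

lemma ex_cond_exp_invariant_measure:
  fixes T :: "'a::{t2_space, second_countable_topology} \<Rightarrow> 'a"
  assumes "weighted_local_homeo T g"
  obtains \<mu> where "sets \<mu> = sets borel" "prob_space \<mu>" "weighted_local_homeo.cond_exp_invariant T g \<mu>"
proof -
  interpret weighted_local_homeo T g by fact
  have "\<forall>n. \<exists>P :: 'a pmf. \<forall>f :: 'a \<Rightarrow> real. measure_pmf.expectation P f = cond_exp n f undefined"
    by (intro allI ex_cond_exp_pmf)
  from choice[OF this] obtain P :: "nat \<Rightarrow> 'a pmf"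
    where "\<forall>n. \<forall>f :: 'a \<Rightarrow> real. measure_pmf.expectation (P n) f = cond_exp n f undefined" ..
  then have P: "measure_pmf.expectation (P n) f = cond_exp n f undefined" for n and f :: "'a \<Rightarrow> real"
    by blast
  obtain r \<mu> where r: "strict_mono (r :: nat \<Rightarrow> nat)" and \<mu>: "sets \<mu> = sets borel" "prob_space \<mu>"
    and lim: "\<And>f :: 'a \<Rightarrow> real. continuous_on UNIV f \<Longrightarrow>
       (\<lambda>k. measure_pmf.expectation (P (r k)) f) \<longlonglongrightarrow> integral\<^sup>L \<mu> f"
    using pmf_sequence_weak_limit[OF compact_UNIV, of P] by metis
  have "integral\<^sup>L \<mu> (cond_exp n f) = integral\<^sup>L \<mu> f" if f: "continuous_on UNIV f" for n and f :: "'a \<Rightarrow> real"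
  proof -
    have "eventually (\<lambda>k. measure_pmf.expectation (P (r k)) (cond_exp n f) = measure_pmf.expectation (P (r k)) f) sequentially"
      unfolding eventually_sequentially P
    proof (intro exI[of _ n] allI impI)
      fix k assume "n \<le> k"
      then have "n \<le> r k" using seq_suble[OF r, of k] by simp
      then show "cond_exp (r k) (cond_exp n f) undefined = cond_exp (r k) f undefined"
        by (simp add: cond_exp_cond_exp)
    qed
    from Lim_transform_eventually[OF lim[OF continuous_cond_exp[OF f]] this]
    show ?thesis using lim[OF f] LIMSEQ_unique by blast
  qed
  then show ?thesis using that \<mu> by (simp add: cond_exp_invariant_def)
qed

section \<open>Exactness and generators\<close>

text \<open>The saturations \<open>A n\<close> of \<open>V\<close> are open and increasing, and they
  cover the space because every class is dense and so meets \<open>V\<close>. By compactness one of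
  them is the whole space, and surjectivity of \<open>T\<close> turns this into the claim about
  images.\<close>

lemma (in compact_local_homeo) minimal_imp_exact:
  assumes surj: "surj T" and minimal: "minimal_rel (tail_rel T)" and V: "open V" "V \<noteq> {}"
  obtains m where "\<And>m'. m \<le> m' \<Longrightarrow> (T ^^ m') ` V = UNIV"
proof -
  define A where "A n = (T ^^ n) -` (T ^^ n) ` V" for n
  have A_mono: "A n \<subseteq> A n'" if n': "n \<le> n'" for n n'
  proof -
    obtain k where "n' = k + n" using n' by (metis le_Suc_ex add.commute)
    then show ?thesis by (auto simp: A_def funpow_add)
  qed
  have "open (A n)" for n
  proof -
    interpret Tn: compact_local_homeo "T ^^ n" by (rule funpow)
    show ?thesis unfolding A_def by (intro open_vimage Tn.open_map_T V Tn.continuous_T)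
  qed
  moreover have "UNIV \<subseteq> (\<Union>n\<in>UNIV. A n)"
  proof
    fix x
    have "closure {y. (x, y) \<in> tail_rel T} = UNIV" using minimal by (simp add: minimal_rel_def)
    then have "V \<inter> {y. (x, y) \<in> tail_rel T} \<noteq> {}"
      using open_Int_closure_eq_empty[OF V(1)] V(2) by (metis inf_top.right_neutral)
    then obtain y n where "y \<in> V" "(T ^^ n) x = (T ^^ n) y"
      by (auto simp: tail_rel_def tail_rel_level_def)
    then show "x \<in> (\<Union>n\<in>UNIV. A n)" unfolding A_def by blast
  qed
  ultimately obtain F where F: "finite F" "UNIV \<subseteq> (\<Union>n\<in>F. A n)"
    using compactE_image[OF compact_UNIV, of UNIV A] by metis
  obtain m where m: "\<And>n. n \<in> F \<Longrightarrow> n \<le> m"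
    using finite_nat_set_iff_bounded_le[of F] F(1) by blast
  show ?thesis
  proof (rule that[of m])
    fix m' assume "m \<le> m'"
    then have "A m' = UNIV" using F(2) A_mono m by (blast intro: le_trans)
    show "(T ^^ m') ` V = UNIV"
    proof (intro equalityI subsetI UNIV_I)
      fix u
      obtain x where "u = (T ^^ m') x" using surjD[OF surj_fn[OF surj]] ..
      moreover have "x \<in> A m'" by (simp add: \<open>A m' = UNIV\<close>)
      ultimately show "u \<in> (T ^^ m') ` V" by (simp add: A_def)
    qed
  qed
qed

text \<open>Prepends one letter to an admissible word; \<open>case_nat U u\<close> is the longer
  word.\<close>

lemma cover_level_Cons:
  assumes "\<forall>k<n. u k \<in> \<U>" "\<forall>k. Suc k < n \<longrightarrow> S ` u k = v (u (Suc k))"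
    and "U \<in> \<U>" "S ` U = v (u 0)"
  shows "U \<inter> S -` (\<Inter>k<n. (S ^^ k) -` u k) \<in> cover_level S \<U> v (Suc n)"
proof -
  have "U \<inter> S -` (\<Inter>k<n. (S ^^ k) -` u k) = (\<Inter>k<Suc n. (S ^^ k) -` case_nat U u k)"
    unfolding lessThan_Suc_eq_insert_0 by (auto simp: funpow_Suc_right simp del: funpow.simps(2))
  moreover have "\<forall>k<Suc n. case_nat U u k \<in> \<U>"
    using assms(1,3) by (auto split: nat.split)
  moreover have "\<forall>k. Suc k < Suc n \<longrightarrow> S ` case_nat U u k = v (case_nat U u (Suc k))"
    using assms(2,4) by (auto split: nat.split)
  ultimately show ?thesis unfolding cover_level_def by blast
qed

text \<open>Extracts from a generator what the Harnack inequality uses: finite open covers that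
  shrink uniformly to the diagonal and, for two points in a common set of level \<open>n\<close>, an
  injection between their fibres whose pairs share a set of level n + 1. The injection follows
  inverse branches; the shrinking is compactness applied to closures.\<close>

lemma (in compact_local_homeo) generator_cover_sequence:
  assumes "generator T \<V> \<U>"
  obtains \<W> :: "nat \<Rightarrow> 'a set set" where "\<And>n. finite (\<W> n)" "\<And>n. \<Union>(\<W> n) = UNIV"
    "\<And>n W. W \<in> \<W> n \<Longrightarrow> open W"
    "\<And>D. open D \<Longrightarrow> Id \<subseteq> D \<Longrightarrow> \<exists>N. \<forall>n\<ge>N. \<forall>W\<in>\<W> n. W \<times> W \<subseteq> D"
    "\<And>n W x x'. W \<in> \<W> n \<Longrightarrow> x \<in> W \<Longrightarrow> x' \<in> W \<Longrightarrow>
       \<exists>b. inj_on b (T -` {x}) \<and> b ` (T -` {x}) \<subseteq> T -` {x'} \<and>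
         (\<forall>z\<in>T -` {x}. \<exists>W'\<in>\<W> (Suc n). z \<in> W' \<and> b z \<in> W')"
proof -
  obtain v where cover: "S_cover T \<V> \<U>" and v: "refining_choice \<V> \<U> v"
    and diag: "(\<Inter>n\<in>{1..}. \<Union>U\<in>cover_level T \<U> v n. U \<times> U) = Id"
    using assms unfolding generator_def by blast
  obtain P where fin\<V>: "finite \<V>" and \<V>: "\<Union>\<V> = UNIV"
    and P: "\<And>V. V \<in> \<V> \<Longrightarrow> finite (P V)" "\<And>V. V \<in> \<V> \<Longrightarrow> partition_on (T -` V) (P V)"
      "\<And>V U. V \<in> \<V> \<Longrightarrow> U \<in> P V \<Longrightarrow> open U \<and> (\<exists>h. homeomorphism U V T h)"
    and \<U>: "\<U> = (\<Union>V\<in>\<V>. P V)"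
    using cover unfolding S_cover_def by blast
  have onto: "T ` U = V" and inj: "inj_on T U" if "V \<in> \<V>" "U \<in> P V" for U V
    using P(3)[OF that] unfolding homeomorphism_def by (metis, metis inj_on_inverseI)
  have block: "\<exists>U\<in>P V. z \<in> U" if "V \<in> \<V>" "T z \<in> V" for V z
    using P(2)[OF that(1)] that(2) unfolding partition_on_def by (metis UnionE vimageI)
  have disj: "U = U'" if "V \<in> \<V>" "U \<in> P V" "U' \<in> P V" "z \<in> U" "z \<in> U'" for U U' V z
    using P(2)[OF that(1)] that(2-) unfolding partition_on_def disjoint_def by blast
  have open\<U>: "open U" if "U \<in> \<U>" for U using that P(3) \<U> by blast
  have v\<V>: "v U \<in> \<V>" "closure U \<subseteq> v U" if "U \<in> \<U>" for U
    using v that unfolding refining_choice_def by auto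
  \<comment> \<open>Level \<open>n\<close> consists of words of length n + 1, so that even level 0
    has a first letter, which places the set inside a member of \<open>\<V>\<close>.\<close>
  define \<W> where "\<W> n = cover_level T \<U> v (Suc n)" for n
  \<comment> \<open>The set lies in its first letter \<open>u 0\<close> and hence in
    \<open>v (u 0)\<close>, so every block over \<open>v (u 0)\<close> can be prepended to the
    word.\<close>
  have extend: "\<exists>V\<in>\<V>. W \<subseteq> V \<and> (\<forall>U\<in>P V. U \<inter> T -` W \<in> \<W> (Suc n))" if W: "W \<in> \<W> n" for W n
  proof -
    obtain u where u: "W = (\<Inter>k<Suc n. (T ^^ k) -` u k)" "\<forall>k<Suc n. u k \<in> \<U>"
      "\<forall>k. Suc k < Suc n \<longrightarrow> T ` u k = v (u (Suc k))"
      using W unfolding \<W>_def cover_level_def by blast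
    have u0: "u 0 \<in> \<U>" using u(2) by simp
    have "(T ^^ 0) x \<in> u 0" if "x \<in> W" for x using that unfolding u(1) by blast
    then have "W \<subseteq> u 0" by auto
    also have "\<dots> \<subseteq> v (u 0)" using v\<V>(2)[OF u0] closure_subset by blast
    finally have "W \<subseteq> v (u 0)" .
    moreover have "U \<inter> T -` W \<in> \<W> (Suc n)" if "U \<in> P (v (u 0))" for U
      unfolding \<W>_def u(1) using u(2,3)
    proof (rule cover_level_Cons)
      show "U \<in> \<U>" using that v\<V>(1)[OF u0] \<U> by blast
      show "T ` U = v (u 0)" using onto[OF v\<V>(1)[OF u0] that] .
    qed
    ultimately show ?thesis using v\<V>(1)[OF u0] by blast
  qed
  have fin: "finite (\<W> n)" for n
  proof -
    have "\<W> n \<subseteq> (\<lambda>u. \<Inter>k<Suc n. (T ^^ k) -` u k) ` (PiE {..<Suc n} (\<lambda>_. \<U>))"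
    proof
      fix W assume "W \<in> \<W> n"
      then obtain u where u: "W = (\<Inter>k<Suc n. (T ^^ k) -` u k)" "\<forall>k<Suc n. u k \<in> \<U>"
        unfolding \<W>_def cover_level_def by blast
      then show "W \<in> (\<lambda>u. \<Inter>k<Suc n. (T ^^ k) -` u k) ` (PiE {..<Suc n} (\<lambda>_. \<U>))"
        by (intro image_eqI[of _ _ "restrict u {..<Suc n}"]) auto
    qed
    moreover have "finite \<U>" using fin\<V> P(1) \<U> by simp
    ultimately show ?thesis by (meson finite_PiE finite_imageI finite_lessThan finite_subset)
  qed
  have covers: "\<Union>(\<W> n) = UNIV" for n
  proof (induction n)
    case 0
    have "x \<in> \<Union>(\<W> 0)" for x
    proof -
      obtain V where "V \<in> \<V>" "T x \<in> V" using \<V> by blast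
      then obtain U where U: "U \<in> \<U>" "x \<in> U" using block[of V x] \<U> by blast
      have "U \<in> \<W> 0"
        unfolding \<W>_def cover_level_def using U(1) by (intro CollectI exI[of _ "\<lambda>_. U"]) auto
      then show ?thesis using U(2) by blast
    qed
    then show ?case by blast
  next
    case (Suc n)
    have "x \<in> \<Union>(\<W> (Suc n))" for x
    proof -
      obtain W where W: "W \<in> \<W> n" "T x \<in> W" using Suc by blast
      obtain V where V: "V \<in> \<V>" "W \<subseteq> V" "\<forall>U\<in>P V. U \<inter> T -` W \<in> \<W> (Suc n)"
        using extend[OF W(1)] by blast
      then obtain U where "U \<in> P V" "x \<in> U" using block W(2) by blast
      then show ?thesis using V(3) W(2) by blast
    qed
    then show ?case by blast
  qed
  have openW: "open W" if W: "W \<in> \<W> n" for W n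
  proof -
    obtain u where u: "W = (\<Inter>k<Suc n. (T ^^ k) -` u k)" "\<forall>k<Suc n. u k \<in> \<U>"
      using W unfolding \<W>_def cover_level_def by blast
    show ?thesis
      unfolding u(1) using u(2) open\<U>
      by (intro open_INT ballI open_vimage compact_local_homeo.continuous_T[OF funpow]) auto
  qed
  \<comment> \<open>The blocks of a partition of \<open>T -` V\<close> into open sets are relatively closed, so a point of the
    closure of \<open>W\<close> can leave the prescribed itinerary only at its last step.\<close>
  have closureW: "\<exists>W'\<in>\<W> n. closure W \<subseteq> W'" if W: "W \<in> \<W> (Suc n)" for W n
  proof -
    obtain u where u: "W = (\<Inter>k<Suc (Suc n). (T ^^ k) -` u k)" "\<forall>k<Suc (Suc n). u k \<in> \<U>"
      "\<forall>k. Suc k < Suc (Suc n) \<longrightarrow> T ` u k = v (u (Suc k))"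
      using W unfolding \<W>_def cover_level_def by blast
    have "(\<Inter>k<Suc n. (T ^^ k) -` u k) \<in> \<W> n"
      unfolding \<W>_def cover_level_def using u(2,3) by (intro CollectI exI[of _ u]) auto
    moreover have "closure W \<subseteq> (\<Inter>k<Suc n. (T ^^ k) -` u k)"
    proof
      fix x assume x: "x \<in> closure W"
      have cl: "(T ^^ k) x \<in> closure (u k)" if "k < Suc (Suc n)" for k
      proof -
        interpret Tk: compact_local_homeo "T ^^ k" by (rule funpow)
        have "(T ^^ k) ` closure W \<subseteq> closure ((T ^^ k) ` W)"
          by (rule image_closure_subset)
            (auto intro: closure_subset[THEN subsetD] continuous_on_subset[OF Tk.continuous_T])
        also have "\<dots> \<subseteq> closure (u k)"
          using that unfolding u(1) by (intro closure_mono) blast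
        finally show ?thesis using x by blast
      qed
      have "(T ^^ k) x \<in> u k" if k: "k < Suc n" for k
      proof -
        let ?y = "(T ^^ k) x"
        have uk: "u k \<in> \<U>" "u (Suc k) \<in> \<U>" using u(2) k by auto
        obtain V where V: "V \<in> \<V>" "u k \<in> P V" using uk(1) \<U> by blast
        have "V = v (u (Suc k))" using onto[OF V] u(3) k by simp
        then have "T ?y \<in> V" using cl[of "Suc k"] v\<V>(2)[OF uk(2)] k by auto
        then obtain B where B: "B \<in> P V" "?y \<in> B" using block V(1) by blast
        have "B \<inter> u k \<noteq> {}"
          using open_Int_closure_eq_empty[of B "u k"] P(3)[OF V(1) B(1)] cl[of k] k B(2) by auto
        then have "B = u k" using disj[OF V(1) B(1) V(2)] by blast
        then show ?thesis using B(2) by simp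
      qed
      then show "x \<in> (\<Inter>k<Suc n. (T ^^ k) -` u k)" by simp
    qed
    ultimately show ?thesis by blast
  qed
  have small: "\<exists>N. \<forall>n\<ge>N. \<forall>W\<in>\<W> n. W \<times> W \<subseteq> D" if D: "open D" "Id \<subseteq> D" for D
  proof -
    define E where "E n = (\<Union>W\<in>\<W> n. W \<times> W)" for n
    \<comment> \<open>\<open>E n\<close> may fail to be closed. The closed sets \<open>K n\<close>
      lie between E (n + 1) and E n, so they also intersect in the diagonal, and compactness applies
      to them.\<close>
    define K where "K n = (\<Union>W\<in>\<W> (Suc n). closure W \<times> closure W)" for n
    have KE: "K n \<subseteq> E n" for n
    proof
      fix p assume "p \<in> K n"
      then obtain W where W: "W \<in> \<W> (Suc n)" "p \<in> closure W \<times> closure W"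
        unfolding K_def by blast
      obtain W' where "W' \<in> \<W> n" "closure W \<subseteq> W'" using closureW[OF W(1)] by blast
      then show "p \<in> E n" using W(2) unfolding E_def by blast
    qed
    have EK: "E (Suc n) \<subseteq> K n" for n
      unfolding K_def E_def by (intro UN_mono Sigma_mono closure_subset subset_refl)
    have E_anti: "E n' \<subseteq> E n" if "n \<le> n'" for n n'
      using lift_Suc_antimono_le[of E, OF order_trans[OF EK KE] that] .
    have "\<exists>N. (\<Inter>n<N. K n) \<subseteq> D"
    proof (rule compact_INT_closed_subset_open)
      show "compact (UNIV :: ('a \<times> 'a) set)"
        using compact_Times[OF compact_UNIV compact_UNIV] by simp
      show "closed (K n)" for n unfolding K_def using fin by (intro closed_UN closed_Times ballI closed_closure)
      have "(\<Inter>n. K n) \<subseteq> (\<Inter>n. E n)"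
      proof (rule INT_greatest)
        show "(\<Inter>n. K n) \<subseteq> E k" for k using KE[of k] by (rule order_trans[OF INT_lower[OF UNIV_I]])
      qed
      also have "(\<Inter>n. E n) = (\<Inter>n\<in>{1..}. \<Union>U\<in>cover_level T \<U> v n. U \<times> U)"
      proof -
        have "n \<in> range Suc" if "n \<ge> 1" for n :: nat using that by (cases n) auto
        then have "{1..} = range Suc" by auto
        then show ?thesis by (simp add: E_def \<W>_def)
      qed
      finally show "(\<Inter>n. K n) \<subseteq> D" using diag D(2) by simp
    qed (rule D(1))
    then obtain N where N: "(\<Inter>n<N. K n) \<subseteq> D" ..
    have "W \<times> W \<subseteq> D" if "n \<ge> N" "W \<in> \<W> n" for n W
    proof -
      have "W \<times> W \<subseteq> E n" using that(2) unfolding E_def by blast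
      moreover have "E n \<subseteq> K k" if "k < N" for k
        using E_anti[of "Suc k" n] EK[of k] \<open>n \<ge> N\<close> that by simp
      ultimately show ?thesis using N by blast
    qed
    then show ?thesis by blast
  qed
  have lift: "\<exists>b. inj_on b (T -` {x}) \<and> b ` (T -` {x}) \<subseteq> T -` {x'} \<and>
      (\<forall>z\<in>T -` {x}. \<exists>W'\<in>\<W> (Suc n). z \<in> W' \<and> b z \<in> W')"
    if W: "W \<in> \<W> n" "x \<in> W" "x' \<in> W" for n W x x'
  proof -
    obtain V where V: "V \<in> \<V>" "W \<subseteq> V" "\<forall>U\<in>P V. U \<inter> T -` W \<in> \<W> (Suc n)"
      using extend[OF W(1)] by blast
    have "\<exists>U z'. U \<in> P V \<and> z \<in> U \<and> z' \<in> U \<and> T z' = x'" if z: "T z = x" for z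
    proof -
      have "T z \<in> V" using z W(2) V(2) by blast
      then obtain U where U: "U \<in> P V" "z \<in> U" using block[OF V(1)] by blast
      have "x' \<in> T ` U" using onto[OF V(1) U(1)] W(3) V(2) by blast
      then show ?thesis using U by blast
    qed
    then obtain U b where b: "\<And>z. T z = x \<Longrightarrow> U z \<in> P V \<and> z \<in> U z \<and> b z \<in> U z \<and> T (b z) = x'"
      by metis
    \<comment> \<open>Equal images force equal blocks, since the blocks over \<open>V\<close> are
      disjoint, and \<open>T\<close> is injective on a block.\<close>
    have "inj_on b (T -` {x})"
    proof (rule inj_onI)
      fix z w assume zw: "z \<in> T -` {x}" "w \<in> T -` {x}" "b z = b w"
      then have "U z = U w" using disj[OF V(1)] b by (metis vimage_singleton_eq)
      then show "z = w" using inj_onD[OF inj[OF V(1)], of "U z" z w] b[of z] b[of w] zw by auto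
    qed
    moreover have "\<exists>W'\<in>\<W> (Suc n). z \<in> W' \<and> b z \<in> W'" if "z \<in> T -` {x}" for z
      using b[of z] that W V(3) by (intro bexI[of _ "U z \<inter> T -` W"]) auto
    ultimately show ?thesis using b by (intro exI[of _ b]) auto
  qed
  show ?thesis using that[OF fin covers openW small lift] .
qed

text \<open>Lifts one step at a time: \<open>d\<close> matches the fibre over \<open>S z\<close>
  with the fibre over \<open>b (S z)\<close>. Each backward step refines the cover by one level, so
  the paired orbits share a set of level N + n - k at time k, hence of level at least N
  throughout.\<close>

lemma fibre_injection_iterate:
  fixes \<W> :: "nat \<Rightarrow> 'a set set"
  assumes lift: "\<And>n W x x'. W \<in> \<W> n \<Longrightarrow> x \<in> W \<Longrightarrow> x' \<in> W \<Longrightarrow>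
       \<exists>b. inj_on b (S -` {x}) \<and> b ` (S -` {x}) \<subseteq> S -` {x'} \<and>
         (\<forall>z\<in>S -` {x}. \<exists>W'\<in>\<W> (Suc n). z \<in> W' \<and> b z \<in> W')"
    and W: "W \<in> \<W> N" "x \<in> W" "x' \<in> W"
  shows "\<exists>b. inj_on b ((S ^^ n) -` {x}) \<and> b ` ((S ^^ n) -` {x}) \<subseteq> (S ^^ n) -` {x'} \<and>
    (\<forall>z\<in>(S ^^ n) -` {x}. \<forall>k\<le>n. \<exists>W'\<in>\<W> (N + n - k). (S ^^ k) z \<in> W' \<and> (S ^^ k) (b z) \<in> W')"
proof (induction n)
  case 0
  show ?case using W by (intro exI[of _ "\<lambda>_. x'"]) auto
next
  case (Suc n)
  then obtain b where b: "inj_on b ((S ^^ n) -` {x})"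
    "\<And>z. (S ^^ n) z = x \<Longrightarrow> (S ^^ n) (b z) = x'"
    "\<And>z k. (S ^^ n) z = x \<Longrightarrow> k \<le> n \<Longrightarrow> \<exists>W'\<in>\<W> (N + n - k). (S ^^ k) z \<in> W' \<and> (S ^^ k) (b z) \<in> W'"
    by (auto simp: image_subset_iff)
  have "\<exists>c. inj_on c (S -` {a}) \<and> c ` (S -` {a}) \<subseteq> S -` {b a} \<and>
      (\<forall>z\<in>S -` {a}. \<exists>W'\<in>\<W> (Suc (N + n)). z \<in> W' \<and> c z \<in> W')" if a: "(S ^^ n) a = x" for a
  proof -
    obtain W' where "W' \<in> \<W> (N + n)" "a \<in> W'" "b a \<in> W'" using b(3)[OF a, of 0] by auto
    then show ?thesis by (rule lift)
  qed
  then obtain c where c: "\<And>a. (S ^^ n) a = x \<Longrightarrow> inj_on (c a) (S -` {a}) \<and> c a ` (S -` {a}) \<subseteq> S -` {b a} \<and>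
      (\<forall>z\<in>S -` {a}. \<exists>W'\<in>\<W> (Suc (N + n)). z \<in> W' \<and> c a z \<in> W')"
    by metis
  define d where "d z = c (S z) z" for z
  have S_d: "S (d z) = b (S z)" if "(S ^^ n) (S z) = x" for z
    using c[OF that] unfolding d_def by blast
  have fibre: "z \<in> (S ^^ Suc n) -` {x} \<longleftrightarrow> (S ^^ n) (S z) = x" for z x
    by (simp add: funpow_swap1)
  show ?case
  proof (intro exI[of _ d] conjI ballI allI impI)
    show "inj_on d ((S ^^ Suc n) -` {x})"
    proof (rule inj_onI)
      fix z w assume "z \<in> (S ^^ Suc n) -` {x}" "w \<in> (S ^^ Suc n) -` {x}" and eq: "d z = d w"
      then have zw: "(S ^^ n) (S z) = x" "(S ^^ n) (S w) = x" by (simp_all only: fibre)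
      have "b (S z) = b (S w)" using S_d[OF zw(1)] S_d[OF zw(2)] eq by simp
      then have "S z = S w" using inj_onD[OF b(1)] zw by simp
      then show "z = w"
        using c[OF zw(1)] eq unfolding d_def by (metis inj_onD vimage_singleton_eq)
    qed
    show "d ` ((S ^^ Suc n) -` {x}) \<subseteq> (S ^^ Suc n) -` {x'}"
    proof (rule image_subsetI)
      fix z assume "z \<in> (S ^^ Suc n) -` {x}"
      then have "(S ^^ n) (S z) = x" by (simp only: fibre)
      then show "d z \<in> (S ^^ Suc n) -` {x'}" unfolding fibre using S_d b(2) by simp
    qed
    fix z k assume "z \<in> (S ^^ Suc n) -` {x}" and k: "k \<le> Suc n"
    then have z: "(S ^^ n) (S z) = x" by (simp only: fibre)
    show "\<exists>W'\<in>\<W> (N + Suc n - k). (S ^^ k) z \<in> W' \<and> (S ^^ k) (d z) \<in> W'"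
    proof (cases k)
      case 0
      then show ?thesis using c[OF z] by (auto simp: d_def)
    next
      case (Suc j)
      then show ?thesis using b(3)[OF z, of j] k S_d[OF z] by (simp add: funpow_swap1)
    qed
  qed
qed

text \<open>Translates Walters' condition, which concerns \<open>T ^^ M\<close> and the product over
  \<open>M\<close> steps, into orbit products of \<open>g\<close> along \<open>T\<close> at
  multiples of \<open>M\<close>.\<close>

lemma orbit_prod_orbit_prod: "orbit_prod (orbit_prod h S M) (S ^^ M) n = orbit_prod h S (M * n)"
proof (induction n)
  case (Suc n)
  show ?case
  proof
    fix x
    have "orbit_prod (orbit_prod h S M) (S ^^ M) (Suc n) x =
        orbit_prod (orbit_prod h S M) (S ^^ M) n x * orbit_prod h S M ((S ^^ (M * n)) x)"
      by (simp add: orbit_prod_def funpow_mult)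
    also have "\<dots> = orbit_prod h S (M + M * n) x" by (simp add: Suc orbit_prod_add)
    finally show "orbit_prod (orbit_prod h S M) (S ^^ M) (Suc n) x = orbit_prod h S (M * Suc n) x"
      by simp
  qed
qed (simp add: orbit_prod_def fun_eq_iff)

lemma continuous_attains_inf_UNIV:
  fixes f :: "'a::topological_space \<Rightarrow> real"
  assumes "compact (UNIV :: 'a set)" "continuous_on UNIV f"
  obtains x where "\<And>y. f x \<le> f y"
proof -
  obtain x where "\<forall>y\<in>UNIV. f x \<le> f y"
    using continuous_attains_inf[OF assms(1) UNIV_not_empty assms(2)] by blast
  then show ?thesis using that[of x] by simp
qed

text \<open>A real supremum bounds the members of a bounded family; continuity on the compact
  product space provides the boundedness.\<close>

lemma var_star_upper:
  fixes h :: "'a::topological_space \<Rightarrow> real"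
  assumes comp: "compact (UNIV :: 'a set)" and h: "continuous_on UNIV h" "\<And>x. h x > 0"
    and xy: "(x, y) \<in> D"
  shows "\<bar>h x / h y - 1\<bar> \<le> var_star h D"
proof -
  have "compact (UNIV :: ('a \<times> 'a) set)"
    using compact_Times[OF comp comp] by simp
  moreover have "continuous_on UNIV (\<lambda>p. \<bar>h (fst p) / h (snd p) - 1\<bar>)"
    using h(2) by (intro continuous_intros continuous_on_compose2[OF h(1)]) (auto simp: less_imp_neq[symmetric])
  ultimately have "bounded (range (\<lambda>p. \<bar>h (fst p) / h (snd p) - 1\<bar>))"
    by (intro compact_imp_bounded compact_continuous_image)
  then have "bdd_above (range (\<lambda>p. \<bar>h (fst p) / h (snd p) - 1\<bar>))" by (rule bounded_imp_bdd_above)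
  then have "bdd_above ((\<lambda>p. \<bar>h (fst p) / h (snd p) - 1\<bar>) ` D)" by (rule bdd_above_mono) auto
  from cSUP_upper[OF xy this] show ?thesis by (simp add: var_star_def case_prod_unfold)
qed

section \<open>Harnack inequality and uniqueness\<close>

context weighted_local_homeo
begin

text \<open>The 4 is 2 for the weights times 2 for \<open>f\<close>. The injection may miss points
  of the target fibre; positivity allows their terms to be added.\<close>

lemma transfer_le_of_injection:
  fixes f :: "'a \<Rightarrow> real"
  assumes b: "inj_on b ((T ^^ n) -` {x})" "b ` ((T ^^ n) -` {x}) \<subseteq> (T ^^ n) -` {x'}"
    and g: "\<And>z. (T ^^ n) z = x \<Longrightarrow> orbit_prod g T n z \<le> 2 * orbit_prod g T n (b z)"
    and f: "\<And>z. (T ^^ n) z = x \<Longrightarrow> f z \<le> 2 * f (b z)" and f0: "\<And>z. f z > 0"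
  shows "transfer n f x \<le> 4 * transfer n f x'"
proof -
  let ?w = "\<lambda>z. orbit_prod g T n z * f z"
  have nonneg: "?w z \<ge> 0" for z using orbit_prod_pos[of n z] f0[of z] by simp
  have "transfer n f x \<le> (\<Sum>z\<in>(T ^^ n) -` {x}. 4 * ?w (b z))"
    unfolding transfer_def
  proof (rule sum_mono)
    fix z assume "z \<in> (T ^^ n) -` {x}"
    then have z: "(T ^^ n) z = x" by simp
    have "orbit_prod g T n z * f z \<le> (2 * orbit_prod g T n (b z)) * (2 * f (b z))"
      using g[OF z] f[OF z] orbit_prod_pos[of n z] f0[of z] orbit_prod_pos[of n "b z"] by (intro mult_mono) auto
    then show "orbit_prod g T n z *\<^sub>R f z \<le> 4 * ?w (b z)" by simp
  qed
  also have "\<dots> = 4 * (\<Sum>z\<in>b ` ((T ^^ n) -` {x}). ?w z)"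
    using b(1) by (simp add: sum.reindex sum_distrib_left)
  also have "\<dots> \<le> 4 * (\<Sum>z\<in>(T ^^ n) -` {x'}. ?w z)"
    using b(2) nonneg by (intro mult_left_mono sum_mono2 finite_funpow_fibre) auto
  finally show ?thesis by (simp add: transfer_def)
qed

text \<open>Combines the pairing along \<open>T ^^ L\<close> with Walters' condition along
  \<open>T ^^ M\<close> at the common times \<open>L * (M * q)\<close>. The paired orbits are close
  at multiples of \<open>L\<close>; the neighbourhood \<open>D\<close> also controls the L - 1 steps
  that follow, which makes the orbits close at the multiples of \<open>M\<close>.\<close>

lemma bounded_distortion:
  assumes LM: "L \<ge> 1" "M \<ge> 1" and walters: "walters_condition (T ^^ M) (orbit_prod g T M)"
    and small: "\<And>D. open D \<Longrightarrow> Id \<subseteq> D \<Longrightarrow> \<exists>N. \<forall>n\<ge>N. \<forall>W\<in>\<W> n. W \<times> W \<subseteq> D"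
    and lift: "\<And>n W x x'. W \<in> \<W> n \<Longrightarrow> x \<in> W \<Longrightarrow> x' \<in> W \<Longrightarrow>
       \<exists>b. inj_on b ((T ^^ L) -` {x}) \<and> b ` ((T ^^ L) -` {x}) \<subseteq> (T ^^ L) -` {x'} \<and>
         (\<forall>z\<in>(T ^^ L) -` {x}. \<exists>W'\<in>\<W> (Suc n). z \<in> W' \<and> b z \<in> W')"
  obtains N where "\<And>q W x x'. W \<in> \<W> N \<Longrightarrow> x \<in> W \<Longrightarrow> x' \<in> W \<Longrightarrow>
    \<exists>b. inj_on b ((T ^^ (L * (M * q))) -` {x}) \<and> b ` ((T ^^ (L * (M * q))) -` {x}) \<subseteq> (T ^^ (L * (M * q))) -` {x'} \<and>
      (\<forall>z\<in>(T ^^ (L * (M * q))) -` {x}. orbit_prod g T (L * (M * q)) z \<le> 2 * orbit_prod g T (L * (M * q)) (b z) \<and>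
         (\<exists>W'\<in>\<W> (N + M * q). z \<in> W' \<and> b z \<in> W'))"
proof -
  \<comment> \<open>Taking \<epsilon> = 1 yields the factor 2: a ratio within distance 1 of 1 is at
    most 2.\<close>
  have "(1::real) > 0" by simp
  from walters[unfolded walters_condition_def, rule_format, OF this]
  obtain \<Delta> where \<Delta>: "entourage \<Delta>"
    and var: "\<forall>n\<ge>1. var_star (orbit_prod (orbit_prod g T M) (T ^^ M) n) (entourage_level (T ^^ M) \<Delta> n) \<le> 1"
    by (elim exE conjE) (rule that)
  define D where "D = (\<Inter>r<L. (\<lambda>p. ((T ^^ r) (fst p), (T ^^ r) (snd p))) -` interior \<Delta>)"
  have "open D"
    unfolding D_def
    by (intro open_INT ballI open_vimage continuous_on_Pair continuous_on_compose2[OF continuous_funpow[of UNIV]]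
        continuous_on_fst continuous_on_snd continuous_on_id) auto
  moreover have "Id \<subseteq> D" using \<Delta> by (auto simp: D_def entourage_def)
  ultimately have "\<exists>N. \<forall>n\<ge>N. \<forall>W\<in>\<W> n. W \<times> W \<subseteq> D" by (rule small)
  then obtain N where N: "\<forall>n\<ge>N. \<forall>W\<in>\<W> n. W \<times> W \<subseteq> D" ..
  have dist: "orbit_prod g T (L * (M * q)) z \<le> 2 * orbit_prod g T (L * (M * q)) z'"
    if close: "\<And>k. k \<le> M * q \<Longrightarrow> (((T ^^ L) ^^ k) z, ((T ^^ L) ^^ k) z') \<in> D" for q z z'
  \<comment> \<open>For \<open>q = 0\<close> both products are empty, whereas Walters' condition
    starts with one factor.\<close>
  proof (cases "q = 0")
    case False
    define h where "h = orbit_prod (orbit_prod g T M) (T ^^ M) (L * q)"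
    have h: "h = orbit_prod g T (L * (M * q))"
      unfolding h_def orbit_prod_orbit_prod by (simp add: mult.left_commute)
    have "(z, z') \<in> entourage_level (T ^^ M) \<Delta> (L * q)"
      unfolding entourage_level_def
    proof (clarify)
      fix j assume j: "j < L * q"
      \<comment> \<open>Time \<open>M * j\<close> is reached from the multiple \<open>L * k\<close>
        by \<open>r < L\<close> further steps.\<close>
      define k r where "k = (M * j) div L" and "r = (M * j) mod L"
      have Mj: "M * j = r + L * k" by (simp add: k_def r_def)
      have "L * k \<le> M * j" using Mj by simp
      also have "\<dots> \<le> M * (L * q)" using j by simp
      finally have "L * k \<le> L * (M * q)" by (simp add: mult.left_commute)
      then have k: "k \<le> M * q" using LM(1) by simp
      have "r < L" unfolding r_def using LM(1) by simp
      then have "((T ^^ r) (((T ^^ L) ^^ k) z), (T ^^ r) (((T ^^ L) ^^ k) z')) \<in> interior \<Delta>"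
        using close[OF k] by (auto simp: D_def)
      moreover have "(T ^^ r) (((T ^^ L) ^^ k) y) = ((T ^^ M) ^^ j) y" for y
        by (simp add: funpow_mult Mj funpow_add)
      ultimately show "(((T ^^ M) ^^ j) z, ((T ^^ M) ^^ j) z') \<in> \<Delta>"
        using interior_subset by auto
    qed
    then have "\<bar>h z / h z' - 1\<bar> \<le> var_star h (entourage_level (T ^^ M) \<Delta> (L * q))"
      unfolding h by (intro var_star_upper compact_UNIV continuous_orbit_prod orbit_prod_pos)
    also have "\<dots> \<le> 1" unfolding h_def using False LM by (intro var[rule_format]) simp
    finally have "h z / h z' \<le> 2" by linarith
    moreover have "h z' > 0" unfolding h by (rule orbit_prod_pos)
    ultimately show ?thesis unfolding h[symmetric] by (simp add: pos_divide_le_eq)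
  qed (simp add: orbit_prod_def)
  show ?thesis
  proof (rule that[of N])
    fix q W x x' assume W: "W \<in> \<W> N" "x \<in> W" "x' \<in> W"
    have "\<exists>b. inj_on b (((T ^^ L) ^^ (M * q)) -` {x}) \<and>
      b ` (((T ^^ L) ^^ (M * q)) -` {x}) \<subseteq> ((T ^^ L) ^^ (M * q)) -` {x'} \<and>
      (\<forall>z\<in>((T ^^ L) ^^ (M * q)) -` {x}. \<forall>k\<le>M * q. \<exists>W'\<in>\<W> (N + M * q - k).
         ((T ^^ L) ^^ k) z \<in> W' \<and> ((T ^^ L) ^^ k) (b z) \<in> W')"
      by (rule fibre_injection_iterate[where \<W> = \<W> and N = N and W = W, OF _ W], rule lift)
    then obtain b where b: "inj_on b (((T ^^ L) ^^ (M * q)) -` {x})"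
      "b ` (((T ^^ L) ^^ (M * q)) -` {x}) \<subseteq> ((T ^^ L) ^^ (M * q)) -` {x'}"
      "\<forall>z\<in>((T ^^ L) ^^ (M * q)) -` {x}. \<forall>k\<le>M * q. \<exists>W'\<in>\<W> (N + M * q - k).
         ((T ^^ L) ^^ k) z \<in> W' \<and> ((T ^^ L) ^^ k) (b z) \<in> W'"
      by (elim exE conjE) (rule that)
    have eq: "(T ^^ L) ^^ (M * q) = T ^^ (L * (M * q))" by (simp add: funpow_mult)
    have "orbit_prod g T (L * (M * q)) z \<le> 2 * orbit_prod g T (L * (M * q)) (b z) \<and>
         (\<exists>W'\<in>\<W> (N + M * q). z \<in> W' \<and> b z \<in> W')" if z: "z \<in> (T ^^ (L * (M * q))) -` {x}" for z
    proof
      show "orbit_prod g T (L * (M * q)) z \<le> 2 * orbit_prod g T (L * (M * q)) (b z)"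
      proof (rule dist)
        fix k assume k: "k \<le> M * q"
        then obtain W' where "W' \<in> \<W> (N + M * q - k)" "((T ^^ L) ^^ k) z \<in> W'" "((T ^^ L) ^^ k) (b z) \<in> W'"
          using b(3) z unfolding eq by blast
        moreover have "N + M * q - k \<ge> N" using k by simp
        ultimately show "(((T ^^ L) ^^ k) z, ((T ^^ L) ^^ k) (b z)) \<in> D" using N by blast
      qed
      show "\<exists>W'\<in>\<W> (N + M * q). z \<in> W' \<and> b z \<in> W'"
        using bspec[OF b(3), of z] z unfolding eq by (force dest: spec[of _ 0])
    qed
    then show "\<exists>b. inj_on b ((T ^^ (L * (M * q))) -` {x}) \<and> b ` ((T ^^ (L * (M * q))) -` {x}) \<subseteq> (T ^^ (L * (M * q))) -` {x'} \<and>
      (\<forall>z\<in>(T ^^ (L * (M * q))) -` {x}. orbit_prod g T (L * (M * q)) z \<le> 2 * orbit_prod g T (L * (M * q)) (b z) \<and>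
         (\<exists>W'\<in>\<W> (N + M * q). z \<in> W' \<and> b z \<in> W'))"
      using b(1,2) unfolding eq by blast
  qed
qed

text \<open>Some \<open>T ^^ m\<close> maps every nonempty set of level \<open>N\<close> onto the
  space. Hence each point \<open>v\<close> of a fibre of \<open>T ^^ m\<close> shares a set with
  some point \<open>a\<close> of any other such fibre, and the local comparison of \<open>v\<close>
  with \<open>a\<close> sums up to a comparison of transfers at arbitrary points. Applied to
  \<open>f\<close> and to 1, it compares the quotients.\<close>

lemma cond_exp_harnack:
  assumes minimal: "minimal_rel (tail_rel T)"
    and L: "L \<ge> 1" "generator (T ^^ L) \<V> \<U>"
    and M: "M \<ge> 1" "walters_condition (T ^^ M) (orbit_prod g T M)"
  obtains C :: real where "C > 1" "\<And>(f :: 'a \<Rightarrow> real) n0. continuous_on UNIV f \<Longrightarrow> (\<And>x. f x > 0) \<Longrightarrow>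
    \<exists>n\<ge>n0. \<forall>x y. cond_exp n f x \<le> C * cond_exp n f y"
proof -
  interpret S: compact_local_homeo "T ^^ L" by (rule funpow)
  obtain \<W> :: "nat \<Rightarrow> 'a set set" where \<W>: "\<And>n. finite (\<W> n)" "\<And>n. \<Union>(\<W> n) = UNIV"
      "\<And>n W. W \<in> \<W> n \<Longrightarrow> open W"
    and small: "\<And>D. open D \<Longrightarrow> Id \<subseteq> D \<Longrightarrow> \<exists>N. \<forall>n\<ge>N. \<forall>W\<in>\<W> n. W \<times> W \<subseteq> D"
    and lift: "\<And>n W x x'. W \<in> \<W> n \<Longrightarrow> x \<in> W \<Longrightarrow> x' \<in> W \<Longrightarrow>
       \<exists>b. inj_on b ((T ^^ L) -` {x}) \<and> b ` ((T ^^ L) -` {x}) \<subseteq> (T ^^ L) -` {x'} \<and>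
         (\<forall>z\<in>(T ^^ L) -` {x}. \<exists>W'\<in>\<W> (Suc n). z \<in> W' \<and> b z \<in> W')"
    by (rule S.generator_cover_sequence[OF L(2)]; rule that)
  obtain N where N: "\<And>q W x x'. W \<in> \<W> N \<Longrightarrow> x \<in> W \<Longrightarrow> x' \<in> W \<Longrightarrow>
    \<exists>b. inj_on b ((T ^^ (L * (M * q))) -` {x}) \<and> b ` ((T ^^ (L * (M * q))) -` {x}) \<subseteq> (T ^^ (L * (M * q))) -` {x'} \<and>
      (\<forall>z\<in>(T ^^ (L * (M * q))) -` {x}. orbit_prod g T (L * (M * q)) z \<le> 2 * orbit_prod g T (L * (M * q)) (b z) \<and>
         (\<exists>W'\<in>\<W> (N + M * q). z \<in> W' \<and> b z \<in> W'))"
    by (rule bounded_distortion[OF L(1) M, of \<W>]; (rule small lift that)?; assumption?)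
  have "\<exists>m. W \<noteq> {} \<longrightarrow> (\<forall>m'\<ge>m. (T ^^ m') ` W = UNIV)" if W: "W \<in> \<W> N" for W
  proof (cases "W = {}")
    case False
    obtain m where "\<And>m'. m \<le> m' \<Longrightarrow> (T ^^ m') ` W = UNIV"
      using minimal_imp_exact[OF surj_T minimal \<W>(3)[OF W] False] by blast
    then show ?thesis by blast
  qed simp
  then obtain mm where mm: "\<And>W m'. W \<in> \<W> N \<Longrightarrow> W \<noteq> {} \<Longrightarrow> mm W \<le> m' \<Longrightarrow> (T ^^ m') ` W = UNIV"
    by metis
  obtain m where m: "\<And>W. W \<in> \<W> N \<Longrightarrow> mm W \<le> m"
    using finite_nat_set_iff_bounded_le[of "mm ` \<W> N"] \<W>(1) by auto
  have exact: "\<exists>a\<in>W. (T ^^ m) a = u" if "W \<in> \<W> N" "W \<noteq> {}" for W u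
    using mm[OF that m[OF that(1)]] by (metis UNIV_I imageE)
  \<comment> \<open>\<open>c\<close> bounds the single weights of \<open>m\<close> steps from below
    and \<open>B\<close> their fibre sums from above; with the 4 of
    \<open>transfer_le_of_injection\<close> they make up \<open>A\<close>.\<close>
  obtain c where c: "c > 0" "\<And>x. orbit_prod g T m x \<ge> c"
    using continuous_attains_inf_UNIV[OF compact_UNIV continuous_orbit_prod[of UNIV m]] orbit_prod_pos by metis
  obtain B where B: "\<And>u. transfer m (\<lambda>_. 1 :: real) u \<le> B"
  proof -
    have "continuous_on UNIV (\<lambda>u. - transfer m (\<lambda>_. 1 :: real) u)"
      by (intro continuous_on_minus continuous_transfer continuous_on_const)
    then obtain u0 where "\<And>u. - transfer m (\<lambda>_. 1 :: real) u0 \<le> - transfer m (\<lambda>_. 1) u"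
      by (rule continuous_attains_inf_UNIV[OF compact_UNIV]) blast
    then show ?thesis using that[of "transfer m (\<lambda>_. 1) u0"] by simp
  qed
  define A where "A = 4 * B / c"
  have compare: "transfer (m + L * (M * q)) f u' \<le> A * transfer (m + L * (M * q)) f u"
    if f: "\<And>x. f x > 0" "\<And>W z z'. W \<in> \<W> (N + M * q) \<Longrightarrow> z \<in> W \<Longrightarrow> z' \<in> W \<Longrightarrow> f z \<le> 2 * f z'"
    for f :: "'a \<Rightarrow> real" and q u u'
  proof -
    let ?n = "L * (M * q)"
    have pos: "transfer n f v > 0" for n v
    proof -
      obtain z where "(T ^^ n) z = v" using surjD[OF surj_fn[OF surj_T, of n], of v] by metis
      then have "(T ^^ n) -` {v} \<noteq> {}" by auto
      then show ?thesis
        unfolding transfer_def by (intro sum_pos finite_funpow_fibre) (simp_all add: orbit_prod_pos f)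
    qed
    \<comment> \<open>The point \<open>a\<close> lies over \<open>u\<close> in the same set as
      \<open>v\<close>, and its term alone is a lower bound for the sum that gives the transfer at
      \<open>u\<close>.\<close>
    have lower: "transfer ?n f v \<le> 4 / c * transfer (m + ?n) f u" for v
    proof -
      obtain W where W: "W \<in> \<W> N" "v \<in> W" using \<W>(2) by blast
      then obtain a where a: "a \<in> W" "(T ^^ m) a = u" using exact by blast
      from N[OF W(1,2) a(1), of q]
      obtain b where b: "inj_on b ((T ^^ ?n) -` {v})" "b ` ((T ^^ ?n) -` {v}) \<subseteq> (T ^^ ?n) -` {a}"
        "\<forall>z\<in>(T ^^ ?n) -` {v}. orbit_prod g T ?n z \<le> 2 * orbit_prod g T ?n (b z) \<and>
           (\<exists>W'\<in>\<W> (N + M * q). z \<in> W' \<and> b z \<in> W')"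
        by (elim exE conjE) (rule that)
      have 1: "transfer ?n f v \<le> 4 * transfer ?n f a"
        by (rule transfer_le_of_injection[OF b(1,2) _ _ f(1)]) (use b(3) f(2) in auto)
      have "c * transfer ?n f a \<le> orbit_prod g T m a * transfer ?n f a"
        using c(2) pos[of ?n a] by (intro mult_right_mono) auto
      also have "\<dots> \<le> transfer (m + ?n) f u"
        unfolding transfer_add transfer_def[of m]
        using a(2) member_le_sum[of a "(T ^^ m) -` {u}" "\<lambda>z. orbit_prod g T m z *\<^sub>R transfer ?n f z"]
          pos[of ?n] orbit_prod_pos[of m] by (auto simp: finite_funpow_fibre less_imp_le)
      finally have "4 * transfer ?n f a \<le> 4 / c * transfer (m + ?n) f u"
        using c(1) by (simp add: field_simps)
      then show ?thesis using 1 by simp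
    qed
    have "transfer (m + ?n) f u' = transfer m (transfer ?n f) u'" by (simp add: transfer_add)
    also have "\<dots> \<le> transfer m (\<lambda>_. 4 / c * transfer (m + ?n) f u) u'"
      by (rule transfer_mono[OF lower])
    also have "\<dots> = transfer m (\<lambda>_. 1) u' * (4 / c * transfer (m + ?n) f u)" by (rule transfer_const)
    also have "\<dots> \<le> B * (4 / c * transfer (m + ?n) f u)"
      using B pos[of "m + ?n" u] c(1) by (intro mult_right_mono) (auto simp: less_imp_le)
    finally show ?thesis by (simp add: A_def mult_ac)
  qed
  show ?thesis
  \<comment> \<open>One factor \<open>A\<close> compares numerators and one compares denominators;
    adding 2 makes the constant exceed 1.\<close>
  proof (rule that[of "A\<^sup>2 + 2"])
    show "A\<^sup>2 + 2 > 1" using zero_le_power2[of A] by linarith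
    fix f :: "'a \<Rightarrow> real" and n0 assume f: "continuous_on UNIV f" "\<And>x. f x > 0"
    have "open {p. f (fst p) < 2 * f (snd p)}"
      by (intro open_Collect_less continuous_intros continuous_on_compose2[OF f(1)]) auto
    moreover have "Id \<subseteq> {p. f (fst p) < 2 * f (snd p)}" using f(2) by auto
    ultimately have "\<exists>N. \<forall>n\<ge>N. \<forall>W\<in>\<W> n. W \<times> W \<subseteq> {p. f (fst p) < 2 * f (snd p)}" by (rule small)
    then obtain N' where N': "\<forall>n\<ge>N'. \<forall>W\<in>\<W> n. W \<times> W \<subseteq> {p. f (fst p) < 2 * f (snd p)}" ..
    \<comment> \<open>Large enough for \<open>f\<close> to vary by a factor of at most 2 on sets of
      level \<open>N + M * q\<close>, and for the time to be at least \<open>n0\<close>.\<close>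
    define q where "q = N' + n0"
    let ?n = "m + L * (M * q)"
    have q: "N' \<le> q" "n0 \<le> q" by (simp_all add: q_def)
    have qM: "q \<le> M * q" and qL: "M * q \<le> L * (M * q)" using M(1) L(1) by simp_all
    have f2: "f z \<le> 2 * f z'" if "W \<in> \<W> (N + M * q)" "z \<in> W" "z' \<in> W" for W z z'
    proof -
      have "N' \<le> N + M * q" using qM q(1) by linarith
      then show ?thesis using N'[rule_format, OF _ that(1)] that(2,3) by fastforce
    qed
    have "cond_exp ?n f x \<le> (A\<^sup>2 + 2) * cond_exp ?n f y" for x y
    proof -
      let ?x = "(T ^^ ?n) x" and ?y = "(T ^^ ?n) y"
      have t: "transfer ?n f ?x \<le> A * transfer ?n f ?y" using f(2) f2 by (intro compare) auto
      \<comment> \<open>The constant function 1 enters through the denominators, so here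
        \<open>x\<close> and \<open>y\<close> exchange roles.\<close>
      have t1: "transfer ?n (\<lambda>_. 1 :: real) ?y \<le> A * transfer ?n (\<lambda>_. 1) ?x" by (intro compare) auto
      have p: "transfer ?n (\<lambda>_. 1 :: real) ?x > 0" "transfer ?n (\<lambda>_. 1 :: real) ?y > 0"
        by (rule transfer_one_pos)+
      have A: "A > 0" using t1 p by (metis less_le_trans zero_less_mult_pos2)
      have f0: "transfer ?n f v \<ge> 0" for v
        unfolding transfer_def using f(2) orbit_prod_pos
        by (intro sum_nonneg) (auto simp: less_imp_le)
      have "transfer ?n f ?x * transfer ?n (\<lambda>_. 1) ?y \<le> (A * transfer ?n f ?y) * (A * transfer ?n (\<lambda>_. 1) ?x)"
        using t t1 f0 p A by (intro mult_mono) auto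
      also have "\<dots> \<le> (A\<^sup>2 + 2) * (transfer ?n f ?y * transfer ?n (\<lambda>_. 1) ?x)"
        using f0[of ?y] p by (simp add: power2_eq_square algebra_simps)
      finally show ?thesis
        unfolding cond_exp_def using p by (simp add: field_simps)
    qed
    then show "\<exists>n\<ge>n0. \<forall>x y. cond_exp n f x \<le> (A\<^sup>2 + 2) * cond_exp n f y"
      using qM qL q(2) by (intro exI[of _ ?n] conjI) (linarith, blast)
  qed
qed

section \<open>Contraction of oscillations and uniqueness\<close>

lemma cond_exp_add_const:
  fixes f :: "'a \<Rightarrow> real"
  shows "cond_exp n (\<lambda>x. f x + c) x = cond_exp n f x + c"
  by (simp add: cond_exp_plus cond_exp_const)

text \<open>If an average has oscillation at most \<open>b\<close>, shift its minimum to b / C.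
  Harnack bounds the next differences by 1 - 1 / C times the upper bound b + b / C of the shifted
  function, which equals (1 - 1 / C^2) b. Iteration drives the oscillation to 0.\<close>

lemma cond_exp_oscillation_small:
  fixes f :: "'a \<Rightarrow> real"
  assumes C: "C > 1" "\<And>(f :: 'a \<Rightarrow> real) n0. continuous_on UNIV f \<Longrightarrow> (\<And>x. f x > 0) \<Longrightarrow>
      \<exists>n\<ge>n0. \<forall>x y. cond_exp n f x \<le> C * cond_exp n f y"
    and f: "continuous_on UNIV f" and "\<epsilon> > 0"
  shows "\<exists>n. \<forall>x y. cond_exp n f x - cond_exp n f y \<le> \<epsilon>"
proof -
  define \<theta> where "\<theta> = 1 - 1 / C\<^sup>2"
  have \<theta>: "0 < \<theta>" "\<theta> < 1" using C(1) by (simp_all add: \<theta>_def field_simps one_less_power)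
  have step: "\<exists>n. \<forall>x y. cond_exp n f x - cond_exp n f y \<le> \<theta> * b"
    if b: "b > 0" and n: "\<forall>x y. cond_exp n f x - cond_exp n f y \<le> b" for b n
  proof -
    obtain y0 where y0: "\<And>y. cond_exp n f y0 \<le> cond_exp n f y"
      using continuous_attains_inf_UNIV[OF compact_UNIV continuous_cond_exp[OF f]] by blast
    \<comment> \<open>The minimum of \<open>h\<close> becomes b / C. Any positive value below b / (C
      - 1) would contract; this one gives the factor \<theta>.\<close>
    define d where "d = b / C - cond_exp n f y0"
    define h where "h x = cond_exp n f x + d" for x
    have "b / C > 0" using b C(1) by simp
    then have h0: "h x > 0" for x using y0[of x] by (simp add: h_def d_def)
    have hb: "h x \<le> b + b / C" for x
      using n[rule_format, of x y0] by (simp add: h_def d_def)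
    have "continuous_on UNIV h"
      unfolding h_def[abs_def] by (intro continuous_on_add continuous_cond_exp f continuous_on_const)
    from C(2)[OF this h0, of n] obtain n' where n': "n \<le> n'" "\<And>x y. cond_exp n' h x \<le> C * cond_exp n' h y"
      by blast
    have eq: "cond_exp n' h x = cond_exp n' f x + d" for x
      unfolding h_def[abs_def] by (simp add: cond_exp_add_const cond_exp_cond_exp[OF n'(1)])
    have le: "cond_exp n' h x \<le> b + b / C" for x
      using cond_exp_mono[of h "\<lambda>_. b + b / C" n' x] hb by (simp add: cond_exp_const)
    have "cond_exp n' f x - cond_exp n' f y \<le> \<theta> * b" for x y
    proof -
      have "cond_exp n' h x / C \<le> cond_exp n' h y"
        using n'(2)[of x y] C(1) by (simp add: field_simps)
      moreover have "cond_exp n' f x - cond_exp n' f y = cond_exp n' h x - cond_exp n' h y"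
        by (simp add: eq)
      ultimately have "cond_exp n' f x - cond_exp n' f y \<le> (1 - 1 / C) * cond_exp n' h x"
        by (simp add: left_diff_distrib)
      also have "\<dots> \<le> (1 - 1 / C) * (b + b / C)"
        using C(1) le by (intro mult_left_mono) auto
      also have "\<dots> = \<theta> * b" using C(1) by (simp add: \<theta>_def field_simps power2_eq_square)
      finally show ?thesis .
    qed
    then show ?thesis by blast
  qed
  have "bounded (range f)" using compact_continuous_image[OF f compact_UNIV] by (rule compact_imp_bounded)
  then obtain B where B: "\<And>x. \<bar>f x\<bar> \<le> B" unfolding bounded_iff by auto
  have B': "- B \<le> cond_exp 0 f x" "cond_exp 0 f x \<le> B" for x
  proof -
    have "f x \<le> B" "- B \<le> f x" for x using B[of x] by linarith+
    then show "- B \<le> cond_exp 0 f x" "cond_exp 0 f x \<le> B"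
      using cond_exp_mono[of f "\<lambda>_. B" 0 x] cond_exp_mono[of "\<lambda>_. - B" f 0 x] by (simp_all add: cond_exp_const)
  qed
  \<comment> \<open>2 * B bounds the initial oscillation; adding 1 makes the bound positive, as
    \<open>step\<close> requires.\<close>
  define b where "b = 2 * B + 1"
  have "B \<ge> 0" using B[of undefined] by linarith
  then have b: "b > 0" by (simp add: b_def)
  have iter: "\<exists>n. \<forall>x y. cond_exp n f x - cond_exp n f y \<le> \<theta> ^ k * b" for k
  proof (induction k)
    case 0
    have "cond_exp 0 f x - cond_exp 0 f y \<le> b" for x y
      using B'(2)[of x] B'(1)[of y] by (simp add: b_def)
    then show ?case by (intro exI[of _ 0]) simp
  next
    case (Suc k)
    then show ?case using step[of "\<theta> ^ k * b"] \<theta>(1) b by (auto simp: mult.assoc)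
  qed
  obtain k where "\<theta> ^ k < \<epsilon> / b" using real_arch_pow_inv[of "\<epsilon> / b" \<theta>] \<theta> b \<open>\<epsilon> > 0\<close> by auto
  then have "\<theta> ^ k * b \<le> \<epsilon>" using b by (simp add: field_simps)
  then show ?thesis using iter[of k] by (meson order_trans)
qed

end

text \<open>If \<open>cond_exp n f\<close> is within \<epsilon> / 2 of a constant, here its value at
  \<open>undefined\<close>, then so is the integral of \<open>f\<close> for every invariant
  probability measure. Two such integrals differ by at most \<epsilon>, and continuous functions
  determine the measure.\<close>

lemma cond_exp_invariant_unique:
  fixes T :: "'a::{t2_space, second_countable_topology} \<Rightarrow> 'a"
  assumes "weighted_local_homeo T g"
    and osc: "\<And>(f :: 'a \<Rightarrow> real) \<epsilon>. continuous_on UNIV f \<Longrightarrow> \<epsilon> > 0 \<Longrightarrow>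
      \<exists>n. \<forall>x y. weighted_local_homeo.cond_exp T g n f x - weighted_local_homeo.cond_exp T g n f y \<le> \<epsilon>"
    and \<mu>: "sets \<mu> = sets borel" "prob_space \<mu>" "weighted_local_homeo.cond_exp_invariant T g \<mu>"
    and \<nu>: "sets \<nu> = sets borel" "prob_space \<nu>" "weighted_local_homeo.cond_exp_invariant T g \<nu>"
  shows "\<mu> = \<nu>"
proof -
  interpret weighted_local_homeo T g by fact
  show ?thesis
  proof (rule prob_measure_eqI_continuous[OF compact_UNIV \<mu>(1,2) \<nu>(1,2)])
    fix f :: "'a \<Rightarrow> real" assume f: "continuous_on UNIV f"
    have "\<bar>integral\<^sup>L \<mu> f - integral\<^sup>L \<nu> f\<bar> \<le> 0 + \<epsilon>" if "\<epsilon> > 0" for \<epsilon>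
    proof -
      have "\<epsilon> / 2 > 0" using that by simp
      from osc[OF f this] obtain n where n: "\<forall>x y. cond_exp n f x - cond_exp n f y \<le> \<epsilon> / 2" ..
      let ?a = "cond_exp n f undefined"
      have bound: "\<bar>integral\<^sup>L \<kappa> f - ?a\<bar> \<le> \<epsilon> / 2"
        if \<kappa>: "sets \<kappa> = sets borel" "prob_space \<kappa>" "cond_exp_invariant \<kappa>" for \<kappa>
      proof -
        interpret \<kappa>: prob_space \<kappa> by (rule \<kappa>)
        have i: "integrable \<kappa> (cond_exp n f)"
          by (rule integrable_continuous_compact[OF compact_UNIV \<kappa>(1,2) continuous_cond_exp[OF f]])
        have "cond_exp n f x \<le> ?a + \<epsilon> / 2" "?a - \<epsilon> / 2 \<le> cond_exp n f x" for x
          using n[rule_format, of x undefined] n[rule_format, of undefined x] by linarith+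
        then have "integral\<^sup>L \<kappa> (cond_exp n f) \<le> ?a + \<epsilon> / 2" "?a - \<epsilon> / 2 \<le> integral\<^sup>L \<kappa> (cond_exp n f)"
          using \<kappa>.integral_le_const[OF i] \<kappa>.integral_ge_const[OF i] by auto
        moreover have "integral\<^sup>L \<kappa> (cond_exp n f) = integral\<^sup>L \<kappa> f"
          using \<kappa>(3) f unfolding cond_exp_invariant_def by blast
        ultimately show ?thesis by linarith
      qed
      show ?thesis using bound[OF \<mu>] bound[OF \<nu>] by linarith
    qed
    then have "\<bar>integral\<^sup>L \<mu> f - integral\<^sup>L \<nu> f\<bar> \<le> 0" by (rule field_le_epsilon)
    then show "integral\<^sup>L \<mu> f = integral\<^sup>L \<nu> f" by simp
  qed
qed

theorem corollary6p2:
  fixes T :: "'a::{t2_space, second_countable_topology} \<Rightarrow> 'a"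
    and g :: "'a \<Rightarrow> real"
  assumes "compact (UNIV :: 'a set)"
    and "surj T" and "local_homeomorphism T"
    and "continuous_on UNIV g" and "\<And>x. g x > 0"
    and "minimal_rel (tail_rel T)"
    and "\<exists>L\<ge>1. \<exists>\<V> \<U>. generator (T ^^ L) \<V> \<U>"
    and "\<exists>M\<ge>1. walters_condition (T ^^ M) (orbit_prod g T M)"
  shows "uniquely_ergodic T (stationary_cocycle g T)"
proof -
  interpret compact_local_homeo T
    using assms(1,3) by (rule local_homeomorphism_imp_compact_local_homeo)
  have w: "weighted_local_homeo T g"
    by unfold_locales (use assms(2,4,5) in auto)
  interpret weighted_local_homeo T g by (rule w)
  obtain L \<V> \<U> M where LM: "L \<ge> 1" "generator (T ^^ L) \<V> \<U>" "M \<ge> 1" "walters_condition (T ^^ M) (orbit_prod g T M)"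
    using assms(7,8) by blast
  obtain C :: real where C: "C > 1" "\<And>(f :: 'a \<Rightarrow> real) n0. continuous_on UNIV f \<Longrightarrow> (\<And>x. f x > 0) \<Longrightarrow>
      \<exists>n\<ge>n0. \<forall>x y. cond_exp n f x \<le> C * cond_exp n f y"
    using cond_exp_harnack[OF assms(6) LM] by blast
  obtain \<mu> where \<mu>: "sets \<mu> = sets borel" "prob_space \<mu>" "cond_exp_invariant \<mu>"
    using ex_cond_exp_invariant_measure[OF w] by blast
  show ?thesis
    unfolding uniquely_ergodic_def
  proof (rule ex1I[of _ \<mu>])
    show "sets \<mu> = sets borel \<and> prob_space \<mu> \<and> quasi_invariant_RN T (stationary_cocycle g T) \<mu>"
      using \<mu> cond_exp_invariant_imp_quasi_invariant by blast
    fix \<nu> assume "sets \<nu> = sets borel \<and> prob_space \<nu> \<and> quasi_invariant_RN T (stationary_cocycle g T) \<nu>"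
    then have "sets \<nu> = sets borel" "prob_space \<nu>" "cond_exp_invariant \<nu>"
      using quasi_invariant_imp_cond_exp_invariant by auto
    then show "\<nu> = \<mu>"
      using cond_exp_invariant_unique[OF w cond_exp_oscillation_small[OF C]] \<mu> by blast
  qed
qed

end
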